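(* Let $\Sigma$ be a finite CW complex of dimension $d$, let $C$ be a circuit of the cellular matroid of $\Sigma$, and let $\Delta=\Sigma_{(d-1)}\cup C$. Then there are signs $\epsilon_\sigma\in\{\pm1\}$ ($\sigma\in C$) such that the vector $$\sum_{\sigma\in C}\epsilon_\sigma\,\mathbf{t}_{d-1}(\Delta\setminus\sigma)\,\sigma$$ spans the (one-dimensional) space of vectors in the flow space $\ker_{\mathbb{R}}\partial_d$ supported on $C$; in particular it is a nonzero flow vector with support exactly $C$.
   Context: $\Sigma$ has the convention of a unique $(-1)$-cell (reduced homology); $\Sigma_{(d-1)}$ is the $(d-1)$-skeleton; $d$-cells are facets, oriented, identified with the standard basis of $C_d(\Sigma;\mathbb{R})$; $\partial_d$ is the top cellular boundary map. The cellular matroid is the matroid on the facets represented over $\mathbb{R}$ by the columns of $\partial_d$; a circuit is a minimal linearly dependent set of columns. $\Delta\setminus\sigma$ denotes the subcomplex $\Sigma_{(d-1)}\cup(C\setminus\{\sigma\})$, and $\mathbf{t}_{d-1}(X)=|\operatorname{tor}(\tilde H_{d-1}(X;\mathbb{Z}))|$. *)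

theory Defs
  imports "HOL-Homology.Homology" "HOL-Library.Function_Algebras"
begin

text \<open>
  Pointwise real vector space structure on functions, so that chains and matrix columns are
  vectors for the library notions \<^const>\<open>span\<close>, \<^const>\<open>dim\<close> and \<^const>\<open>independent\<close>.
\<close>

instantiation "fun" :: (type, scaleR) scaleR
begin

definition scaleR_fun :: "real \<Rightarrow> ('a \<Rightarrow> 'b) \<Rightarrow> 'a \<Rightarrow> 'b" where
  "scaleR_fun r f = (\<lambda>x. r *\<^sub>R f x)"

instance ..

end

instance "fun" :: (type, real_vector) real_vector
  by standard (simp_all add: scaleR_fun_def fun_eq_iff scaleR_add_right scaleR_add_left)


text \<open>
  The disc, its boundary sphere and its interior in \<^const>\<open>Euclidean_space\<close> \<open>n\<close>, whose points are
  the real sequences vanishing from index \<open>n\<close> on. For \<open>n = 0\<close> the disc and its interior are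
  a point and the sphere is empty.
\<close>

definition disc_top :: "nat \<Rightarrow> (nat \<Rightarrow> real) topology" where
  "disc_top n = subtopology (Euclidean_space n) {x. (\<Sum>i<n. (x i)\<^sup>2) \<le> 1}"

definition disc_boundary :: "nat \<Rightarrow> (nat \<Rightarrow> real) set" where
  "disc_boundary n = {x \<in> topspace (Euclidean_space n). (\<Sum>i<n. (x i)\<^sup>2) = 1}"

definition disc_interior :: "nat \<Rightarrow> (nat \<Rightarrow> real) set" where
  "disc_interior n = {x \<in> topspace (Euclidean_space n). (\<Sum>i<n. (x i)\<^sup>2) < 1}"


text \<open>
  A cell structure on a space: nonempty cells, indexed by a set, with dimensions and
  characteristic maps. The cell itself is the open cell, the image of the open disc.
\<close>

record ('a, 'c) cell_structure =
  cw_space :: "'a topology"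
  cells :: "'c set"
  cell_dim :: "'c \<Rightarrow> nat"
  char_map :: "'c \<Rightarrow> (nat \<Rightarrow> real) \<Rightarrow> 'a"

definition open_cell :: "('a, 'c) cell_structure \<Rightarrow> 'c \<Rightarrow> 'a set" where
  "open_cell S e = char_map S e ` disc_interior (cell_dim S e)"

definition n_cells :: "('a, 'c) cell_structure \<Rightarrow> nat \<Rightarrow> 'c set" where
  "n_cells S n = {e \<in> cells S. cell_dim S e = n}"

definition skeleton :: "('a, 'c) cell_structure \<Rightarrow> int \<Rightarrow> 'a set" where
  "skeleton S k = (\<Union>e \<in> {e \<in> cells S. int (cell_dim S e) \<le> k}. open_cell S e)"

text \<open>
  For finitely many cells in a Hausdorff space, these conditions imply that characteristic maps
  restrict to homeomorphisms from open discs to open cells, closure finiteness, and the weak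
  topology (closed cells are compact, hence closed, and finitely many).
\<close>

definition finite_cw_complex :: "('a, 'c) cell_structure \<Rightarrow> bool" where
  "finite_cw_complex S \<longleftrightarrow>
     Hausdorff_space (cw_space S) \<and>
     finite (cells S) \<and>
     (\<forall>e \<in> cells S.
        continuous_map (disc_top (cell_dim S e)) (cw_space S) (char_map S e) \<and>
        inj_on (char_map S e) (disc_interior (cell_dim S e)) \<and>
        char_map S e ` disc_boundary (cell_dim S e) \<subseteq> skeleton S (int (cell_dim S e) - 1)) \<and>
     disjoint_family_on (open_cell S) (cells S) \<and>
     topspace (cw_space S) = (\<Union>e \<in> cells S. open_cell S e)"

definition cw_dimension :: "('a, 'c) cell_structure \<Rightarrow> nat \<Rightarrow> bool" where
  "cw_dimension S d \<longleftrightarrow> (\<forall>e \<in> cells S. cell_dim S e \<le> d) \<and> (\<exists>e \<in> cells S. cell_dim S e = d)"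


text \<open>
  Integral cellular chains \<open>H\<^sub>k(X\<^sub>k, X\<^sub>k\<^sub>-\<^sub>1)\<close> and the cellular boundary, the composite
  \<open>H\<^sub>k(X\<^sub>k, X\<^sub>k\<^sub>-\<^sub>1) \<rightarrow> H\<^sub>k\<^sub>-\<^sub>1(X\<^sub>k\<^sub>-\<^sub>1) \<rightarrow> H\<^sub>k\<^sub>-\<^sub>1(X\<^sub>k\<^sub>-\<^sub>1, X\<^sub>k\<^sub>-\<^sub>2)\<close>. The library writes homology groups
  multiplicatively.
\<close>

definition skeleton_top :: "('a, 'c) cell_structure \<Rightarrow> int \<Rightarrow> 'a topology" where
  "skeleton_top S k = subtopology (cw_space S) (skeleton S k)"

definition cellular_chain_group :: "('a, 'c) cell_structure \<Rightarrow> int \<Rightarrow> 'a chain set monoid" where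
  "cellular_chain_group S k = relative_homology_group k (skeleton_top S k) (skeleton S (k - 1))"

definition cellular_boundary ::
    "('a, 'c) cell_structure \<Rightarrow> int \<Rightarrow> 'a chain set \<Rightarrow> 'a chain set" where
  "cellular_boundary S k =
     hom_induced (k - 1) (skeleton_top S (k - 1)) {} (skeleton_top S (k - 1)) (skeleton S (k - 2)) id
     \<circ> hom_boundary k (skeleton_top S k) (skeleton S (k - 1))"

text \<open>
  A reference orientation of the disc: a generator of the infinite cyclic group
  \<open>H\<^sub>n(D\<^sup>n, S\<^sup>n\<^sup>-\<^sup>1)\<close>, chosen once for each \<open>n\<close>. A cell is oriented by its characteristic map; for
  \<open>n > 0\<close> the other orientation is obtained by precomposing with a reflection of the disc.
\<close>

definition disc_orientation :: "nat \<Rightarrow> (nat \<Rightarrow> real) chain set" where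
  "disc_orientation n =
     (SOME w. w \<in> carrier (relative_homology_group (int n) (disc_top n) (disc_boundary n)) \<and>
        generate (relative_homology_group (int n) (disc_top n) (disc_boundary n)) {w} =
        carrier (relative_homology_group (int n) (disc_top n) (disc_boundary n)))"

definition cell_class :: "('a, 'c) cell_structure \<Rightarrow> 'c \<Rightarrow> 'a chain set" where
  "cell_class S e =
     (let n = cell_dim S e in
      hom_induced (int n) (disc_top n) (disc_boundary n)
        (skeleton_top S (int n)) (skeleton S (int n - 1)) (char_map S e) (disc_orientation n))"

text \<open>
  In a finite CW complex the classes of the \<open>n\<close>-cells form a basis of the free abelian group of
  \<open>n\<close>-chains; the following are the integer coordinates in that basis.
\<close>

definition cell_coords :: "('a, 'c) cell_structure \<Rightarrow> nat \<Rightarrow> 'a chain set \<Rightarrow> 'c \<Rightarrow> int" where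
  "cell_coords S n z =
     (THE a. (\<forall>e. e \<notin> n_cells S n \<longrightarrow> a e = 0) \<and>
        z = finprod (cellular_chain_group S (int n))
              (\<lambda>e. cell_class S e [^]\<^bsub>cellular_chain_group S (int n)\<^esub> a e) (n_cells S n))"

text \<open>
  Incidence numbers of the augmented (reduced) cellular chain complex. Rows are indexed by
  \<^typ>\<open>'c option\<close>: \<^term>\<open>None\<close> is the unique \<open>(-1)\<close>-cell, which lies in the boundary of every
  vertex with coefficient \<open>1\<close>.
\<close>

fun incidence :: "('a, 'c) cell_structure \<Rightarrow> 'c \<Rightarrow> 'c option \<Rightarrow> int" where
  "incidence S e None = (if cell_dim S e = 0 then 1 else 0)"
| "incidence S e (Some f) =
     (if cell_dim S e = 0 then 0
      else cell_coords S (cell_dim S e - 1)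
             (cellular_boundary S (int (cell_dim S e)) (cell_class S e)) f)"

definition boundary_column :: "('a, 'c) cell_structure \<Rightarrow> 'c \<Rightarrow> 'c option \<Rightarrow> real" where
  "boundary_column S e = (\<lambda>r. of_int (incidence S e r))"

text \<open>Real \<open>d\<close>-chains are the functions supported on the \<open>d\<close>-cells.\<close>

definition real_chains :: "('a, 'c) cell_structure \<Rightarrow> nat \<Rightarrow> ('c \<Rightarrow> real) set" where
  "real_chains S d = {x. \<forall>e. e \<notin> n_cells S d \<longrightarrow> x e = 0}"

definition basis_chain :: "'c \<Rightarrow> 'c \<Rightarrow> real" where
  "basis_chain e = (\<lambda>f. if f = e then 1 else 0)"

definition real_boundary ::
    "('a, 'c) cell_structure \<Rightarrow> nat \<Rightarrow> ('c \<Rightarrow> real) \<Rightarrow> 'c option \<Rightarrow> real" where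
  "real_boundary S d x = (\<Sum>e \<in> n_cells S d. x e *\<^sub>R boundary_column S e)"

definition flow_space :: "('a, 'c) cell_structure \<Rightarrow> nat \<Rightarrow> ('c \<Rightarrow> real) set" where
  "flow_space S d = {x \<in> real_chains S d. real_boundary S d x = 0}"

definition chain_support :: "('c \<Rightarrow> real) \<Rightarrow> 'c set" where
  "chain_support x = {e. x e \<noteq> 0}"

text \<open>
  The matroid is on facets, not on columns: distinct facets with equal columns are dependent,
  hence the injectivity condition.
\<close>

definition cellular_matroid_indep :: "('a, 'c) cell_structure \<Rightarrow> nat \<Rightarrow> 'c set \<Rightarrow> bool" where
  "cellular_matroid_indep S d A \<longleftrightarrow>
     A \<subseteq> n_cells S d \<and> inj_on (boundary_column S) A \<and> independent (boundary_column S ` A)"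

definition cellular_circuit :: "('a, 'c) cell_structure \<Rightarrow> nat \<Rightarrow> 'c set \<Rightarrow> bool" where
  "cellular_circuit S d C \<longleftrightarrow>
     C \<subseteq> n_cells S d \<and> \<not> cellular_matroid_indep S d C \<and>
     (\<forall>A. A \<subset> C \<longrightarrow> cellular_matroid_indep S d A)"


definition facet_subcomplex :: "('a, 'c) cell_structure \<Rightarrow> nat \<Rightarrow> 'c set \<Rightarrow> 'a topology" where
  "facet_subcomplex S d A =
     subtopology (cw_space S) (skeleton S (int d - 1) \<union> (\<Union>e \<in> A. open_cell S e))"

definition torsion_elements :: "('g, 'm) monoid_scheme \<Rightarrow> 'g set" where
  "torsion_elements G = {x \<in> carrier G. \<exists>n::nat. n > 0 \<and> x [^]\<^bsub>G\<^esub> n = \<one>\<^bsub>G\<^esub>}"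

definition torsion_number :: "int \<Rightarrow> 'a topology \<Rightarrow> nat" where
  "torsion_number k X = card (torsion_elements (reduced_homology_group k X))"

end

theory Submission
  imports Defs "HOL-Analysis.Abstract_Topological_Spaces"
begin

text \<open>
  Write \<open>Z = H\<^sub>d\<^sub>-\<^sub>1(\<Sigma>\<^sub>d\<^sub>-\<^sub>1)\<close>, let \<open>b\<^sub>e \<in> Z\<close> be the attaching class of a facet \<open>e\<close>, and let \<open>\<Delta>\<^sub>A\<close>
  be the \<open>(d-1)\<close>-skeleton together with the facets in \<open>A\<close>. The homology of \<open>\<Delta>\<^sub>A\<close> in degree
  \<open>d-1\<close> is \<open>Z / \<langle>b\<^sub>e | e \<in> A\<rangle>\<close>, and \<open>Z\<close> embeds in the free group of cellular \<open>(d-1)\<close>-chains,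
  carrying \<open>b\<^sub>e\<close> to the column of \<open>e\<close>. Both facts come from attaching one cell at a time, where
  excision identifies the relative homology with that of the disc modulo its boundary.

  For a circuit \<open>C\<close>, the integer relations among the \<open>b\<^sub>e\<close> are the multiples of one relation
  \<open>\<lambda>\<close> with all coordinates nonzero. The projection \<open>Z / \<langle>C - \<sigma>\<rangle> \<rightarrow> Z / \<langle>C\<rangle>\<close> has kernel cyclic of
  order \<open>|\<lambda>\<^sub>\<sigma>|\<close>, generated by the class of \<open>b\<^sub>\<sigma>\<close>, and torsion is exactly the preimage of
  torsion. Hence the torsion number of \<open>\<Delta> - \<sigma>\<close> is \<open>|\<lambda>\<^sub>\<sigma>|\<close> times that of \<open>\<Delta>\<close>, and the vector
  in question is a positive multiple of \<open>\<lambda>\<close>. For \<open>d = 0\<close> there is no torsion, and a circuit is a pair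
  of vertices with \<open>\<lambda> = (1, -1)\<close>.
\<close>

subsection \<open>Discs\<close>

definition sqnorm :: "nat \<Rightarrow> (nat \<Rightarrow> real) \<Rightarrow> real" where
  "sqnorm n x = (\<Sum>i<n. (x i)\<^sup>2)"

text \<open>
  The annulus is kept away from the centre so that it is compact, hence its image in a Hausdorff
  space carries the quotient topology.
\<close>
definition annulus :: "nat \<Rightarrow> (nat \<Rightarrow> real) set" where
  "annulus n = {x \<in> topspace (Euclidean_space n). 1/4 \<le> sqnorm n x \<and> sqnorm n x \<le> 1}"

lemma continuous_on_snd_coordinate:
  "continuous_on A (\<lambda>z :: 'b::topological_space \<times> (nat \<Rightarrow> real). snd z i)"
  by (rule continuous_on_compose2[OF continuous_on_product_coordinates, of _ snd])
    (auto intro: continuous_intros)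

lemma sqnorm_nonneg: "0 \<le> sqnorm n x"
  by (simp add: sqnorm_def sum_nonneg)

lemma sqnorm_scale: "sqnorm n (\<lambda>i. c * x i) = c\<^sup>2 * sqnorm n x"
  by (simp add: sqnorm_def power_mult_distrib sum_distrib_left)

lemma continuous_on_sqnorm: "continuous_on A (sqnorm n)"
  unfolding sqnorm_def
  by (intro continuous_on_sum continuous_on_power continuous_on_product_coordinates
      continuous_on_subset[OF _ subset_UNIV])

lemma topspace_disc_top: "topspace (disc_top n) = {x. (\<forall>i\<ge>n. x i = 0) \<and> sqnorm n x \<le> 1}"
  by (auto simp: disc_top_def topspace_Euclidean_space sqnorm_def)

lemma disc_boundary_eq: "disc_boundary n = {x. (\<forall>i\<ge>n. x i = 0) \<and> sqnorm n x = 1}"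
  by (auto simp: disc_boundary_def topspace_Euclidean_space sqnorm_def)

lemma disc_interior_eq: "disc_interior n = {x. (\<forall>i\<ge>n. x i = 0) \<and> sqnorm n x < 1}"
  by (auto simp: disc_interior_def topspace_Euclidean_space sqnorm_def)

lemma annulus_eq: "annulus n = {x. (\<forall>i\<ge>n. x i = 0) \<and> 1/4 \<le> sqnorm n x \<and> sqnorm n x \<le> 1}"
  by (auto simp: annulus_def topspace_Euclidean_space)

text \<open>Continuity and closedness in \<open>disc_top\<close> thereby become statements about
  subsets of the product space of real sequences, where the euclidean library applies.\<close>

lemma disc_top_eq: "disc_top n = top_of_set (topspace (disc_top n))"
  unfolding disc_top_def Euclidean_space_def euclidean_product_topology
  by (simp add: subtopology_subtopology topspace_subtopology)

lemma subtopology_disc_top: "subtopology (disc_top n) A = top_of_set (topspace (disc_top n) \<inter> A)"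
  by (subst disc_top_eq) (simp add: subtopology_subtopology)

lemma topspace_disc_decomp: "topspace (disc_top n) = disc_boundary n \<union> disc_interior n"
  and disc_boundary_interior_disjoint: "disc_boundary n \<inter> disc_interior n = {}"
  and annulus_subset: "annulus n \<subseteq> topspace (disc_top n)"
  and disc_boundary_subset_annulus: "disc_boundary n \<subseteq> annulus n"
  by (auto simp: topspace_disc_top disc_boundary_eq disc_interior_eq annulus_eq)

lemma closed_zero_beyond: "closed {x :: nat \<Rightarrow> real. \<forall>i\<ge>n. x i = 0}"
proof -
  have "closed {x :: nat \<Rightarrow> real. x i = 0}" for i
    by (rule closed_Collect_eq) (auto intro: continuous_on_product_coordinates)
  moreover have "{x :: nat \<Rightarrow> real. \<forall>i\<ge>n. x i = 0} = (\<Inter>i\<in>{n..}. {x. x i = 0})"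
    by auto
  ultimately show ?thesis by auto
qed

lemma closed_disc: "closed (topspace (disc_top n))"
proof -
  have "topspace (disc_top n) = {x. \<forall>i\<ge>n. x i = 0} \<inter> {x. sqnorm n x \<le> 1}"
    by (auto simp: topspace_disc_top)
  moreover have "closed {x. sqnorm n x \<le> 1}"
    by (intro closed_Collect_le continuous_on_sqnorm continuous_on_const)
  ultimately show ?thesis using closed_zero_beyond by auto
qed

text \<open>A closed subset of the cube with all coordinates in [-1, 1], which is compact by
  Tychonoff.\<close>

lemma compact_space_disc: "compact_space (disc_top n)"
proof -
  have "compactin (product_topology (\<lambda>i. euclideanreal) UNIV) (PiE UNIV (\<lambda>i. {-1..1}))"
    by (subst compactin_PiE) auto
  then have cpt: "compact (PiE UNIV (\<lambda>i::nat. {-1..1::real}))"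
    by (simp add: euclidean_product_topology)
  have sub: "topspace (disc_top n) \<subseteq> PiE UNIV (\<lambda>i::nat. {-1..1::real})"
  proof
    fix x assume x: "x \<in> topspace (disc_top n)"
    have "x i \<in> {-1..1}" for i
    proof (cases "i < n")
      case True
      then have "(x i)\<^sup>2 \<le> sqnorm n x"
        unfolding sqnorm_def by (intro member_le_sum) auto
      then have "(x i)\<^sup>2 \<le> 1" using x by (auto simp: topspace_disc_top)
      then show ?thesis by (simp add: abs_le_iff abs_square_le_1 minus_le_iff)
    qed (use x in \<open>auto simp: topspace_disc_top\<close>)
    then show "x \<in> PiE UNIV (\<lambda>i::nat. {-1..1::real})" by auto
  qed
  have "compact (topspace (disc_top n))"
    using compact_Int_closed[OF cpt closed_disc[of n]] sub by (simp add: Int_absorb1)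
  then show ?thesis
    by (subst disc_top_eq) (simp add: compact_space_subtopology)
qed

lemma Hausdorff_space_disc: "Hausdorff_space (disc_top n)"
  by (simp add: disc_top_def Hausdorff_Euclidean_space Hausdorff_space_subtopology)

text \<open>The straight-line homotopy shrinks the disc to its centre; scaling by
  \<open>1 - t\<close> multiplies \<open>sqnorm\<close> by at most 1.\<close>

lemma contractible_space_disc: "contractible_space (disc_top n)"
proof -
  let ?D = "topspace (disc_top n)"
  have "continuous_on ({0..1} \<times> ?D) (\<lambda>z i. (1 - fst z) * snd z i)"
    by (intro continuous_on_coordinatewise_then_product continuous_on_mult
        continuous_on_snd_coordinate continuous_on_diff continuous_on_const continuous_on_fst
        continuous_on_id)
  moreover have "(\<lambda>i. (1 - t) * x i) \<in> ?D" if "t \<in> {0..1}" "x \<in> ?D" for t :: real and x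
  proof -
    have "(1 - t)\<^sup>2 \<le> 1" using that by (simp add: abs_square_le_1)
    then have "(1 - t)\<^sup>2 * sqnorm n x \<le> 1 * 1"
      using that sqnorm_nonneg by (intro mult_mono) (auto simp: topspace_disc_top)
    then show ?thesis using that by (auto simp: topspace_disc_top sqnorm_scale)
  qed
  moreover have "prod_topology (top_of_set {0..1::real}) (disc_top n) = top_of_set ({0..1} \<times> ?D)"
    by (subst disc_top_eq) (metis prod_topology_euclidean subtopology_Times)
  ultimately have "continuous_map (prod_topology (top_of_set {0..1}) (disc_top n)) (top_of_set ?D)
      (\<lambda>z i. (1 - fst z) * snd z i)"
    by auto
  then have "continuous_map (prod_topology (top_of_set {0..1}) (disc_top n)) (disc_top n)
      (\<lambda>z i. (1 - fst z) * snd z i)"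
    using disc_top_eq by metis
  then have "homotopic_with (\<lambda>x. True) (disc_top n) (disc_top n) id (\<lambda>x i. 0)"
    unfolding homotopic_with_def by (intro exI[of _ "\<lambda>z i. (1 - fst z) * snd z i"]) auto
  then show ?thesis unfolding contractible_space_def by blast
qed


subsection \<open>Attaching a single cell\<close>

text \<open>Radial homotopy taking a point of radius \<open>r\<close> to radius
  \<open>(1 - t) * r + t\<close>, so that time 1 is the radial projection to the sphere. The
  division is safe on \<open>annulus\<close>, where \<open>r\<close> is at least 1/2.\<close>

definition push :: "nat \<Rightarrow> real \<Rightarrow> (nat \<Rightarrow> real) \<Rightarrow> nat \<Rightarrow> real" where
  "push n t x = (\<lambda>i. (1 - t + t / sqrt (sqnorm n x)) * x i)"

lemma continuous_on_push: "continuous_on ({0..1} \<times> annulus n) (\<lambda>z. push n (fst z) (snd z))"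
  unfolding push_def
  by (intro continuous_on_coordinatewise_then_product continuous_on_mult continuous_on_add
      continuous_on_snd_coordinate continuous_on_diff continuous_on_const continuous_on_fst
      continuous_on_id continuous_on_divide continuous_on_real_sqrt continuous_on_snd
      continuous_on_compose2[OF continuous_on_sqnorm[of UNIV]]) (auto simp: annulus_eq)

lemma push_0: "push n 0 x = x"
  by (simp add: push_def)

lemma push_boundary: "x \<in> disc_boundary n \<Longrightarrow> push n t x = x"
  by (simp add: push_def disc_boundary_eq)

lemma sqnorm_push:
  assumes "x \<in> annulus n"
  shows "sqnorm n (push n t x) = ((1 - t) * sqrt (sqnorm n x) + t)\<^sup>2"
proof -
  have "0 < sqnorm n x" using assms by (auto simp: annulus_eq)
  then have "sqnorm n (push n t x) = ((1 - t + t / sqrt (sqnorm n x)) * sqrt (sqnorm n x))\<^sup>2"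
    by (simp add: push_def sqnorm_scale power_mult_distrib)
  also have "(1 - t + t / sqrt (sqnorm n x)) * sqrt (sqnorm n x) = (1 - t) * sqrt (sqnorm n x) + t"
    using \<open>0 < sqnorm n x\<close> by (simp add: field_simps)
  finally show ?thesis .
qed

lemma push_annulus:
  assumes x: "x \<in> annulus n" and t: "t \<in> {0..1}"
  shows "push n t x \<in> annulus n"
proof -
  let ?r = "sqrt (sqnorm n x)"
  have r: "1/2 \<le> ?r" "?r \<le> 1"
    using x real_sqrt_le_mono[of "1/4" "sqnorm n x"] by (auto simp: annulus_eq real_sqrt_divide)
  have "?r \<le> (1 - t) * ?r + t"
    using mult_nonneg_nonneg[of t "1 - ?r"] t r by (auto simp: algebra_simps)
  moreover have "(1 - t) * ?r + t \<le> 1"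
    using mult_nonneg_nonneg[of "1 - t" "1 - ?r"] t r by (auto simp: algebra_simps)
  ultimately have "(1/2)\<^sup>2 \<le> ((1 - t) * ?r + t)\<^sup>2" "((1 - t) * ?r + t)\<^sup>2 \<le> 1\<^sup>2"
    using r by (intro power_mono; linarith)+
  then show ?thesis
    using x sqnorm_push[OF x, of t] by (auto simp: annulus_eq push_def power2_eq_square)
qed

lemma push_1: "x \<in> annulus n \<Longrightarrow> push n 1 x \<in> disc_boundary n"
  using sqnorm_push[of x n 1] by (auto simp: annulus_eq disc_boundary_eq push_def)

text \<open>One cell attached to \<open>Y\<close>, described by its characteristic map instead of a
  quotient construction: a continuous map from the compact disc to a Hausdorff space is
  closed.\<close>

locale cell_attachment =
  fixes n :: nat and X :: "'a topology" and Y :: "'a set" and \<phi> :: "(nat \<Rightarrow> real) \<Rightarrow> 'a"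
  assumes Hausdorff: "Hausdorff_space X"
    and cont: "continuous_map (disc_top n) X \<phi>"
    and inj: "inj_on \<phi> (disc_interior n)"
    and boundary: "\<phi> ` disc_boundary n \<subseteq> Y"
    and closed: "closedin X Y"
    and disjoint: "\<phi> ` disc_interior n \<inter> Y = {}"
    and cover: "topspace X = Y \<union> \<phi> ` disc_interior n"
begin

text \<open>An enlargement of \<open>Y\<close> by the outer shell of the cell. It deforms into
  \<open>Y\<close>, yet contains \<open>Y\<close> in its interior, which is what excision
  requires.\<close>

definition collar :: "'a set" where
  "collar = Y \<union> \<phi> ` annulus n"

lemma Y_subset: "Y \<subseteq> topspace X"
  using cover by auto

lemma collar_subset: "collar \<subseteq> topspace X"
  using cover boundary annulus_subset[of n] image_mono[of "annulus n" "topspace (disc_top n)" \<phi>]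
  unfolding collar_def topspace_disc_decomp image_Un by blast

lemma closed_map_char: "closed_map (disc_top n) X \<phi>"
  by (rule continuous_imp_closed_map_gen[OF compact_space_disc _ cont])
    (rule Hausdorff_imp_kc_space[OF Hausdorff])

lemma compact_annulus: "compact_space (subtopology (disc_top n) (annulus n))"
proof -
  have "closedin (disc_top n) (annulus n)"
  proof -
    have "annulus n = topspace (disc_top n) \<inter> {x. 1/4 \<le> sqnorm n x}"
      by (auto simp: annulus_eq topspace_disc_top)
    moreover have "closed {x. 1/4 \<le> sqnorm n x}"
      by (intro closed_Collect_le continuous_on_sqnorm continuous_on_const)
    ultimately show ?thesis by (subst disc_top_eq) (metis closedin_closed)
  qed
  then show ?thesis
    using closedin_compact_space[OF compact_space_disc] compact_space_subtopology by blast
qed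

section \<open>Deformation of the collar into \<open>Y\<close>\<close>

definition deform :: "real \<times> 'a \<Rightarrow> 'a" where
  "deform z = (if snd z \<in> Y then snd z
     else \<phi> (push n (fst z) (inv_into (disc_interior n) \<phi> (snd z))))"

text \<open>The branches of \<open>deform\<close> agree where they meet: \<open>push\<close> fixes
  the boundary sphere, and \<open>\<phi>\<close> sends it into \<open>Y\<close>. On interior points
  \<open>inv_into\<close> recovers \<open>p\<close> by injectivity.\<close>

lemma deform_char: "p \<in> annulus n \<Longrightarrow> deform (t, \<phi> p) = \<phi> (push n t p)"
proof -
  assume p: "p \<in> annulus n"
  then consider "p \<in> disc_boundary n" | "p \<in> disc_interior n"
    using annulus_subset topspace_disc_decomp by blast
  then show ?thesis
  proof cases
    case 1
    then show ?thesis using boundary by (auto simp: deform_def push_boundary)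
  next
    case 2
    then show ?thesis using disjoint inj by (auto simp: deform_def)
  qed
qed

text \<open>\<open>Y\<close> and the image of the annulus are closed pieces of the collar. Over the
  second piece, the product of the interval with the annulus maps onto its image by a closed, hence
  quotient, map. Continuity can therefore be tested upstairs, where \<open>deform\<close> becomes
  \<open>\<phi>\<close> after \<open>push\<close>.\<close>

lemma continuous_deform:
  "continuous_map (prod_topology (top_of_set {0..1}) (subtopology X collar)) (subtopology X collar) deform"
proof (rule pasting_lemma_closed[where I = "{True, False}" and f = "\<lambda>_. deform"
      and T = "\<lambda>b. {0..1} \<times> (if b then Y else \<phi> ` annulus n)"])
  let ?I = "top_of_set {0..1::real}" and ?N = "subtopology X collar"
    and ?D = "subtopology (disc_top n) (annulus n)"
  let ?P = "prod_topology ?I ?N"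
  have contD: "continuous_map ?D X \<phi>"
    using cont continuous_map_from_subtopology by blast
  have "compactin (disc_top n) (annulus n)"
    using compact_annulus annulus_subset compactin_subspace by blast
  then have cl: "closedin X (\<phi> ` annulus n)"
    using image_compactin[OF _ cont] compactin_imp_closedin[OF Hausdorff] by blast
  then have clN: "closedin ?N (\<phi> ` annulus n)"
    by (rule closedin_subset_topspace) (auto simp: collar_def)
  show "closedin ?P ({0..1} \<times> (if b then Y else \<phi> ` annulus n))" for b
    using clN closedin_subset_topspace[OF closed, of collar]
    by (auto simp: closedin_prod_Times_iff collar_def)
  show "continuous_map (subtopology ?P ({0..1} \<times> (if b then Y else \<phi> ` annulus n))) ?N deform" for b
  proof (cases b)
    case True
    have "continuous_map (subtopology ?P ({0..1} \<times> Y)) ?N snd"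
      by (intro continuous_map_from_subtopology continuous_map_snd)
    then have "continuous_map (subtopology ?P ({0..1} \<times> Y)) ?N deform"
      by (rule continuous_map_eq) (auto simp: deform_def)
    then show ?thesis using True by simp
  next
    case False
    let ?Q = "subtopology ?P ({0..1} \<times> \<phi> ` annulus n)"
    let ?q = "\<lambda>z. (fst z, \<phi> (snd z))"
    have Qeq: "?Q = prod_topology ?I (subtopology X (\<phi> ` annulus n))"
      unfolding subtopology_Times by (simp add: subtopology_subtopology collar_def Int_absorb1 Un_upper2)
    have contq: "continuous_map (prod_topology ?I ?D) ?Q ?q"
      unfolding Qeq continuous_map_pairwise
      using continuous_map_fst[of ?I ?D] continuous_map_compose[OF continuous_map_snd contD, of ?I]
      by (auto simp: o_def continuous_map_in_subtopology)
    have "compact_space (prod_topology ?I ?D)"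
      by (simp add: compact_space_prod_topology compact_annulus compact_space_subtopology)
    moreover have "Hausdorff_space ?Q"
      unfolding Qeq using Hausdorff
      by (simp add: Hausdorff_space_prod_topology Hausdorff_space_subtopology)
    ultimately have "closed_map (prod_topology ?I ?D) ?Q ?q"
      using contq Hausdorff_imp_kc_space continuous_imp_closed_map_gen by blast
    moreover have "?q ` topspace (prod_topology ?I ?D) = topspace ?Q"
      unfolding Qeq using annulus_subset cl[THEN closedin_subset]
      by (force simp: image_iff)
    ultimately have quo: "quotient_map (prod_topology ?I ?D) ?Q ?q"
      using contq continuous_closed_imp_quotient_map by blast
    have "continuous_map (prod_topology ?I ?D) ?D (\<lambda>z. push n (fst z) (snd z))"
    proof -
      have "?D = top_of_set (annulus n)"
        using annulus_subset[of n] by (simp add: subtopology_disc_top Int_absorb1)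
      moreover from this have "prod_topology ?I ?D = top_of_set ({0..1} \<times> annulus n)"
        by (metis prod_topology_euclidean subtopology_Times)
      ultimately show ?thesis
        using continuous_on_push[of n] push_annulus by auto
    qed
    then have "continuous_map (prod_topology ?I ?D) X (\<lambda>z. \<phi> (push n (fst z) (snd z)))"
      using continuous_map_compose[OF _ contD] by (auto simp: o_def)
    then have "continuous_map (prod_topology ?I ?D) ?N (\<lambda>z. \<phi> (push n (fst z) (snd z)))"
      by (auto simp: continuous_map_in_subtopology collar_def push_annulus)
    then have "continuous_map (prod_topology ?I ?D) ?N (deform \<circ> ?q)"
      by (rule continuous_map_eq) (auto simp: deform_char)
    then have "continuous_map ?Q ?N deform"
      by (rule continuous_compose_quotient_map[OF quo])
    then show ?thesis using False by simp
  qed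
  show "\<exists>j. j \<in> {True, False} \<and> x \<in> {0..1} \<times> (if j then Y else \<phi> ` annulus n) \<and> deform x = deform x"
    if "x \<in> topspace ?P" for x
  proof (cases "snd x \<in> Y")
    case True
    then show ?thesis using that by (intro exI[of _ True]) (auto simp: mem_Times_iff)
  next
    case False
    then show ?thesis using that by (intro exI[of _ False]) (auto simp: mem_Times_iff collar_def)
  qed
qed auto

lemma deform_0: "x \<in> collar \<Longrightarrow> deform (0, x) = x"
  by (cases "x \<in> Y") (auto simp: collar_def deform_char push_0, simp add: deform_def)

lemma deform_1: "x \<in> collar \<Longrightarrow> deform (1, x) \<in> Y"
  using push_1 boundary by (cases "x \<in> Y") (auto simp: collar_def deform_char, simp add: deform_def)

text \<open>\<open>deform\<close> is a homotopy from the identity to a map into \<open>Y\<close>,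
  and it keeps \<open>Y\<close> inside \<open>Y\<close> throughout.\<close>

lemma trivial_collar: "trivial_group (relative_homology_group p (subtopology X collar) Y)"
proof (rule trivial_relative_homology_group_alt[where f = "\<lambda>x. deform (1, x)"])
  let ?N = "subtopology X collar"
  have top: "topspace ?N = collar" using collar_subset by auto
  have "continuous_map ?N ?N (deform \<circ> (\<lambda>x. (1, x)))"
    by (rule continuous_map_compose[OF _ continuous_deform]) (simp add: continuous_map_pairwise o_def)
  then show "continuous_map ?N (subtopology ?N Y) (\<lambda>x. deform (1, x))"
    by (auto simp: continuous_map_in_subtopology o_def deform_1)
  have "homotopic_with (\<lambda>k. k ` Y \<subseteq> Y) ?N ?N id (\<lambda>x. deform (1, x))"
  proof (subst homotopic_with)
    show "\<exists>h. continuous_map (prod_topology (top_of_set {0..1::real}) ?N) ?N h \<and>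
       (\<forall>x\<in>topspace ?N. h (0, x) = id x) \<and> (\<forall>x\<in>topspace ?N. h (1, x) = deform (1, x)) \<and>
       (\<forall>t\<in>{0..1}. (\<lambda>x. h (t, x)) ` Y \<subseteq> Y)"
    proof (intro exI[of _ deform] conjI ballI)
      show "(\<lambda>x. deform (t, x)) ` Y \<subseteq> Y" for t by (auto simp: deform_def)
    qed (use continuous_deform deform_0 top in auto)
  qed (use Y_subset in \<open>simp add: image_subset_iff collar_def subset_iff\<close>)
  then show "homotopic_with (\<lambda>k. k ` Y \<subseteq> Y) ?N ?N (\<lambda>x. deform (1, x)) id"
    by (rule homotopic_with_symD)
qed


section \<open>Exact sequence of a triple and excision for one cell\<close>

text \<open>In the exact sequence of the triple \<open>X\<close>, \<open>collar\<close>,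
  \<open>Y\<close> the groups of the collar modulo \<open>Y\<close> vanish on both sides of the
  map.\<close>

lemma iso_rel_collar:
  "hom_induced p X Y X collar id \<in> iso (relative_homology_group p X Y) (relative_homology_group p X collar)"
proof -
  let ?G = "\<lambda>p. relative_homology_group p X Y" and ?H = "\<lambda>p. relative_homology_group p X collar"
    and ?K = "\<lambda>p. relative_homology_group p (subtopology X collar) Y"
  let ?j = "hom_induced p X Y X collar id"
  have sub: "Y \<subseteq> collar" by (auto simp: collar_def)
  interpret j: group_hom "?G p" "?H p" ?j
    by (simp add: group_hom_def group_hom_axioms_def hom_induced_hom)
  interpret i: group_hom "?K p" "?G p" "hom_induced p (subtopology X collar) Y X Y id"
    by (simp add: group_hom_def group_hom_axioms_def hom_induced_hom)
  have "kernel (?G p) (?H p) ?j = hom_induced p (subtopology X collar) Y X Y id ` carrier (?K p)"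
    using homology_exactness_triple_3[OF sub, of p X] by simp
  also have "\<dots> = {\<one>\<^bsub>?G p\<^esub>}"
    using trivial_collar[of p] by (simp add: trivial_group_def)
  finally have "inj_on ?j (carrier (?G p))"
    by (simp add: j.inj_iff_trivial_ker)
  moreover have "?j ` carrier (?G p) = carrier (?H p)"
  proof -
    have "kernel (?H p) (?K (p - 1)) (hom_relboundary p X collar Y) = ?j ` carrier (?G p)"
      using homology_exactness_triple_1[OF sub, of p X] by simp
    moreover have "kernel (?H p) (?K (p - 1)) (hom_relboundary p X collar Y) = carrier (?H p)"
      using trivial_collar[of "p - 1"] hom_relboundary[of p X collar Y]
      by (auto simp: kernel_def trivial_group_def)
    ultimately show ?thesis by simp
  qed
  ultimately show ?thesis
    by (simp add: iso_def bij_betw_def hom_induced_hom)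
qed

lemma iso_excise:
  "hom_induced p (subtopology X (topspace X - Y)) (collar - Y) X collar id
     \<in> iso (relative_homology_group p (subtopology X (topspace X - Y)) (collar - Y))
           (relative_homology_group p X collar)"
proof -
  \<comment> \<open>The image of the ball of radius 1/2 is closed and avoids \<open>Y\<close>. Its
    complement is an open set between \<open>Y\<close> and \<open>collar\<close>, so the closure of
    \<open>Y\<close> lies in the interior of \<open>collar\<close>.\<close>
  let ?B = "{x \<in> topspace (disc_top n). sqnorm n x \<le> 1/4}"
  have "closedin (disc_top n) ?B"
  proof -
    have "?B = topspace (disc_top n) \<inter> {x. sqnorm n x \<le> 1/4}" by auto
    moreover have "closed {x. sqnorm n x \<le> 1/4}"
      by (intro closed_Collect_le continuous_on_sqnorm continuous_on_const)
    ultimately show ?thesis by (subst disc_top_eq) (metis closedin_closed)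
  qed
  then have "closedin X (\<phi> ` ?B)"
    using closed_map_char by (simp add: closed_map_def)
  then have op: "openin X (topspace X - \<phi> ` ?B)" by auto
  have "topspace X - \<phi> ` ?B \<subseteq> collar"
  proof -
    have "p \<in> ?B \<or> p \<in> annulus n" if "p \<in> disc_interior n" for p
      using that by (auto simp: annulus_eq topspace_disc_top disc_interior_eq)
    then show ?thesis using cover by (auto simp: collar_def)
  qed
  then have "topspace X - \<phi> ` ?B \<subseteq> X interior_of collar"
    using op by (rule interior_of_maximal)
  moreover have "Y \<inter> \<phi> ` ?B = {}"
  proof -
    have "?B \<subseteq> disc_interior n" by (auto simp: topspace_disc_top disc_interior_eq)
    then show ?thesis using disjoint by blast
  qed
  ultimately have "X closure_of Y \<subseteq> X interior_of collar"
    using closure_of_closedin[OF closed] Y_subset by blast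
  from homology_excision_axiom[OF this collar_subset, of p] show ?thesis by simp
qed

text \<open>\<open>disc_interior\<close> is the full preimage of the complement of \<open>Y\<close>,
  and a closed map stays closed over a full preimage; bijectivity then gives a
  homeomorphism.\<close>

lemma homeomorphic_map_interior:
  "homeomorphic_map (subtopology (disc_top n) (disc_interior n)) (subtopology X (topspace X - Y)) \<phi>"
proof -
  have pre: "{x \<in> topspace (disc_top n). \<phi> x \<in> topspace X - Y} = disc_interior n"
    using topspace_disc_decomp[of n] cover boundary disjoint by auto
  have img: "\<phi> ` disc_interior n = topspace X - Y"
    using cover disjoint by auto
  have "continuous_map (subtopology (disc_top n) (disc_interior n)) (subtopology X (topspace X - Y)) \<phi>"
    using cont img by (auto simp: continuous_map_in_subtopology continuous_map_from_subtopology)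
  moreover have "closed_map (subtopology (disc_top n) (disc_interior n)) (subtopology X (topspace X - Y)) \<phi>"
    using closed_map_restriction[OF closed_map_char pre] .
  moreover have "topspace (subtopology (disc_top n) (disc_interior n)) = disc_interior n"
    using topspace_disc_decomp[of n] by auto
  ultimately show ?thesis
    using inj img by (intro bijective_closed_imp_homeomorphic_map) auto
qed

end

text \<open>The disc itself arises from its sphere by attaching a cell, so the collar and excision
  isomorphisms hold for the model as well.\<close>

lemma cell_attachment_disc: "cell_attachment n (disc_top n) (disc_boundary n) id"
proof
  have "disc_boundary n = topspace (disc_top n) \<inter> {x. sqnorm n x = 1}"
    by (auto simp: topspace_disc_top disc_boundary_eq)
  moreover have "closed {x. sqnorm n x = 1}"
    by (intro closed_Collect_eq continuous_on_sqnorm continuous_on_const)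
  ultimately show "closedin (disc_top n) (disc_boundary n)"
    by (subst disc_top_eq) (metis closedin_closed)
qed (use topspace_disc_decomp[of n] disc_boundary_interior_disjoint[of n] in
    \<open>auto simp: Hausdorff_space_disc\<close>)

lemma iso_cancel_left:
  assumes "g \<circ> f \<in> iso G K" "g \<in> iso H K" "f \<in> hom G H"
  shows "f \<in> iso G H"
  using assms bij_betw_comp_iff2[of g "carrier H" "carrier K" f "carrier G"]
  by (auto simp: iso_def hom_def)

lemma iso_cancel_right:
  assumes "g \<circ> f \<in> iso G K" "f \<in> iso G H" "g \<in> hom H K"
  shows "g \<in> iso H K"
  using assms bij_betw_comp_iff[of f "carrier G" "carrier H" g "carrier K"]
  by (auto simp: iso_def)

context cell_attachment
begin

text \<open>Enlarging the boundary to the collar is an isomorphism both for the disc and for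
  \<open>X\<close>, and so is excising the boundary, after which \<open>\<phi>\<close> is a
  homeomorphism. Cancelling isomorphisms around the two commuting squares leaves
  \<open>\<phi>\<close> on the original pairs.\<close>

theorem iso_char_map:
  "hom_induced p (disc_top n) (disc_boundary n) X Y \<phi>
     \<in> iso (relative_homology_group p (disc_top n) (disc_boundary n)) (relative_homology_group p X Y)"
proof -
  interpret D: cell_attachment n "disc_top n" "disc_boundary n" id
    by (rule cell_attachment_disc)
  have Dcollar: "D.collar = annulus n"
    using disc_boundary_subset_annulus by (auto simp: D.collar_def)
  let ?D = "disc_top n" and ?S = "disc_boundary n" and ?E = "annulus n"
    and ?U = "topspace (disc_top n) - disc_boundary n" and ?V = "topspace X - Y"
  have U: "?U = disc_interior n"
    using topspace_disc_decomp disc_boundary_interior_disjoint by blast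
  let ?\<phi>D = "hom_induced p ?D ?S X Y \<phi>"
    and ?\<phi>E = "hom_induced p ?D ?E X collar \<phi>"
    and ?\<phi>U = "hom_induced p (subtopology ?D ?U) (?E - ?S) (subtopology X ?V) (collar - Y) \<phi>"
  have E: "\<phi> \<in> ?E \<rightarrow> collar" by (auto simp: collar_def)
  have S: "\<phi> \<in> ?S \<rightarrow> Y" using boundary by auto
  have ES: "\<phi> ` (?E - ?S) = collar - Y"
  proof -
    have "\<phi> x \<notin> Y \<longleftrightarrow> x \<notin> ?S" if "x \<in> ?E" for x
      using that annulus_subset[of n] topspace_disc_decomp[of n] boundary disjoint by blast
    then show ?thesis by (auto simp: collar_def)
  qed
  have homeo: "homeomorphic_map (subtopology ?D ?U) (subtopology X ?V) \<phi>"
    using homeomorphic_map_interior U by simp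
  have isoU: "?\<phi>U \<in> iso (relative_homology_group p (subtopology ?D ?U) (?E - ?S))
                        (relative_homology_group p (subtopology X ?V) (collar - Y))"
    using homeo annulus_subset[of n] ES
    by (intro homeomorphic_map_relative_homology_iso) auto
  have contU: "continuous_map (subtopology ?D ?U) (subtopology X ?V) \<phi>"
    using homeo homeomorphic_imp_continuous_map by blast
  let ?b = "hom_induced p (subtopology ?D ?U) (?E - ?S) ?D ?E id"
    and ?d = "hom_induced p (subtopology X ?V) (collar - Y) X collar id"
    and ?a = "hom_induced p ?D ?S ?D ?E id"
    and ?c = "hom_induced p X Y X collar id"
  \<comment> \<open>Excision square: transfers the isomorphism from the open cells to the pairs with
    the collar.\<close>
  have "hom_induced p (subtopology ?D ?U) (?E - ?S) X collar (\<phi> \<circ> id) = ?\<phi>E \<circ> ?b"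
    using cont E by (intro hom_induced_compose) auto
  moreover have "hom_induced p (subtopology ?D ?U) (?E - ?S) X collar (id \<circ> \<phi>) = ?d \<circ> ?\<phi>U"
    using contU ES by (intro hom_induced_compose) auto
  ultimately have "?\<phi>E \<circ> ?b = ?d \<circ> ?\<phi>U"
    by (simp only: o_id id_o)
  then have "?\<phi>E \<circ> ?b \<in> iso (relative_homology_group p (subtopology ?D ?U) (?E - ?S))
                                 (relative_homology_group p X collar)"
    using iso_set_trans[OF isoU iso_excise] by (simp only:)
  then have isoE: "?\<phi>E \<in> iso (relative_homology_group p ?D ?E) (relative_homology_group p X collar)"
    by (rule iso_cancel_right[OF _ D.iso_excise[of p, unfolded Dcollar] hom_induced_hom])
  \<comment> \<open>Collar square: goes back from the collar to the original boundary.\<close>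
  have "hom_induced p ?D ?S X collar (id \<circ> \<phi>) = ?c \<circ> ?\<phi>D"
    using cont S by (intro hom_induced_compose) (auto simp: collar_def)
  moreover have "hom_induced p ?D ?S X collar (\<phi> \<circ> id) = ?\<phi>E \<circ> ?a"
    using cont E disc_boundary_subset_annulus[of n] by (intro hom_induced_compose) auto
  ultimately have "?c \<circ> ?\<phi>D = ?\<phi>E \<circ> ?a"
    by (simp only: o_id id_o)
  then have "?c \<circ> ?\<phi>D \<in> iso (relative_homology_group p ?D ?S) (relative_homology_group p X collar)"
    using iso_set_trans[OF D.iso_rel_collar[of p, unfolded Dcollar] isoE] by (simp only:)
  then show ?thesis
    by (rule iso_cancel_left[OF _ iso_rel_collar]) (rule hom_induced_hom)
qed

end

subsection \<open>Homology of the disc relative to its boundary\<close>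

lemma disc_sphere: "subtopology (disc_top (Suc n)) (disc_boundary (Suc n)) = nsphere n"
proof -
  let ?E = "Euclidean_space (Suc n)" and ?q = "\<lambda>x::nat \<Rightarrow> real. \<Sum>i\<le>n. (x i)\<^sup>2"
  have "{x. ?q x \<le> 1} \<inter> {x \<in> topspace ?E. ?q x = 1} = topspace ?E \<inter> {x. ?q x = 1}"
    by auto
  then show ?thesis
    by (simp add: disc_top_def nsphere_def subtopology_subtopology disc_boundary_def
        lessThan_Suc_atMost subtopology_restrict)
qed

lemma relative_homology_disc_0:
  "relative_homology_group p (disc_top 0) (disc_boundary 0) = homology_group p (disc_top 0)"
  by (rule arg_cong[where f = "relative_homology_group p _"]) (auto simp: disc_boundary_def)

lemma topspace_disc_0: "topspace (disc_top 0) = {\<lambda>i. 0}"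
  by (auto simp: disc_top_def topspace_Euclidean_space)

text \<open>For \<open>n = 0\<close> the pair is a point with empty boundary. For
  \<open>n > 0\<close> contractibility of the disc shifts the degree down by one, to the reduced
  homology of the sphere.\<close>

lemma trivial_homology_disc:
  assumes "p \<noteq> int n"
  shows "trivial_group (relative_homology_group p (disc_top n) (disc_boundary n))"
proof (cases n)
  case 0
  then show ?thesis
    using homology_dimension_axiom[OF topspace_disc_0] assms
    by (simp add: relative_homology_disc_0)
next
  case (Suc m)
  have "topspace (disc_top n) \<inter> disc_boundary n \<noteq> {}"
    using in_topspace_nsphere[of m] disc_sphere[of m] Suc by (metis empty_iff topspace_subtopology)
  then have "relative_homology_group p (disc_top n) (disc_boundary n) \<cong> reduced_homology_group (p - 1) (nsphere m)"
    using isomorphic_group_relative_homology_of_contractible[OF contractible_space_disc] disc_sphere Suc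
    by metis
  moreover have "trivial_group (reduced_homology_group (p - 1) (nsphere m))"
    using assms Suc by (simp add: trivial_reduced_homology_group_nsphere)
  ultimately show ?thesis
    using isomorphic_group_triviality by (metis group_reduced_homology_group group_relative_homology_group)
qed

lemma homology_disc_iso_integer:
  "relative_homology_group (int n) (disc_top n) (disc_boundary n) \<cong> integer_group"
proof (cases n)
  case 0
  then show ?thesis
    using homology_coefficients[OF topspace_disc_0] by (simp add: relative_homology_disc_0)
next
  case (Suc m)
  have "topspace (disc_top n) \<inter> disc_boundary n \<noteq> {}"
    using in_topspace_nsphere[of m] disc_sphere[of m] Suc by (metis empty_iff topspace_subtopology)
  then have "relative_homology_group (int n) (disc_top n) (disc_boundary n) \<cong> reduced_homology_group (int n - 1) (nsphere m)"
    using isomorphic_group_relative_homology_of_contractible[OF contractible_space_disc] disc_sphere Suc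
    by metis
  also have "\<dots> \<cong> integer_group"
    using reduced_homology_group_nsphere(1)[of m] Suc by simp
  finally show ?thesis .
qed

lemma (in group) generate_singleton: "a \<in> carrier G \<Longrightarrow> generate G {a} = range (\<lambda>m::int. a [^] m)"
  by (subst generate_pow) auto

text \<open>The second part covers an arbitrary generator, as is needed for one obtained by
  \<open>SOME\<close>. Such a generator is \<open>f k\<close> with \<open>k \<noteq> 0\<close>,
  since otherwise the group would be trivial, and its powers correspond to multiples of
  \<open>k\<close>.\<close>

lemma (in group) iso_integer_generator:
  assumes "G \<cong> integer_group"
  shows "\<exists>w. w \<in> carrier G \<and> generate G {w} = carrier G"
    and "\<lbrakk>w \<in> carrier G; generate G {w} = carrier G\<rbrakk> \<Longrightarrow> bij_betw (\<lambda>m::int. w [^] m) UNIV (carrier G)"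
proof -
  obtain f where f: "f \<in> iso integer_group G"
    using iso_sym[OF assms(1)] group.iso_sym[OF is_group assms] by (auto simp: is_iso_def)
  interpret f: group_hom integer_group G f
    using f by (simp add: group_hom_def group_hom_axioms_def iso_def is_group)
  have range: "range f = carrier G" and inj: "inj f"
    using f by (auto simp: iso_def bij_betw_def)
  have pow: "f k [^] m = f (k * m)" for k m :: int
    using f.hom_int_pow[of k m] by (simp add: mult.commute)
  have "range (\<lambda>m::int. f 1 [^] m) = range f"
    by (simp add: pow)
  then show "\<exists>w. w \<in> carrier G \<and> generate G {w} = carrier G"
    using range generate_singleton[of "f 1"] by (intro exI[of _ "f 1"]) auto
  assume w: "w \<in> carrier G" "generate G {w} = carrier G"
  then obtain k where k: "w = f k" using range by auto
  have surj: "range (\<lambda>m::int. w [^] m) = carrier G"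
    using w generate_singleton by simp
  have "k \<noteq> 0"
  proof
    assume "k = 0"
    then have "range (\<lambda>m::int. w [^] m) \<subseteq> {f 0}" by (auto simp: k pow)
    then have "range f \<subseteq> {f 0}" using surj range by simp
    then have "f 1 = f 0" by blast
    then show False using inj by (simp add: inj_eq)
  qed
  then have "inj (\<lambda>m::int. w [^] m)"
    by (intro injI) (auto simp: k pow dest!: injD[OF inj])
  then show "bij_betw (\<lambda>m::int. w [^] m) UNIV (carrier G)"
    using surj by (simp add: bij_betw_def)
qed

lemma
  fixes n :: nat
  defines "G \<equiv> relative_homology_group (int n) (disc_top n) (disc_boundary n)"
  shows disc_orientation_closed: "disc_orientation n \<in> carrier G"
    and bij_disc_orientation: "bij_betw (\<lambda>m::int. disc_orientation n [^]\<^bsub>G\<^esub> m) UNIV (carrier G)"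
proof -
  interpret group G by (simp add: G_def)
  have iso: "G \<cong> integer_group"
    using homology_disc_iso_integer by (simp add: G_def)
  have w: "disc_orientation n \<in> carrier G \<and> generate G {disc_orientation n} = carrier G"
    unfolding disc_orientation_def G_def[symmetric] by (rule someI_ex[OF iso_integer_generator(1)[OF iso]])
  then show "disc_orientation n \<in> carrier G"
    and "bij_betw (\<lambda>m::int. disc_orientation n [^]\<^bsub>G\<^esub> m) UNIV (carrier G)"
    using iso_integer_generator(2)[OF iso] by auto
qed

subsection \<open>Bases of abelian groups\<close>

definition int_comb :: "('g, 'm) monoid_scheme \<Rightarrow> ('c \<Rightarrow> 'g) \<Rightarrow> 'c set \<Rightarrow> ('c \<Rightarrow> int) \<Rightarrow> 'g" where
  "int_comb G c A a = finprod G (\<lambda>e. c e [^]\<^bsub>G\<^esub> a e) A"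

text \<open>Extension by zero outside \<open>A\<close> makes coefficient functions unique, in line
  with the definite description in \<open>cell_coords\<close>.\<close>

definition supported_on :: "'c set \<Rightarrow> ('c \<Rightarrow> int) set" where
  "supported_on A = {a. \<forall>e. e \<notin> A \<longrightarrow> a e = 0}"

definition free_basis :: "('g, 'm) monoid_scheme \<Rightarrow> ('c \<Rightarrow> 'g) \<Rightarrow> 'c set \<Rightarrow> bool" where
  "free_basis G c A \<longleftrightarrow> c \<in> A \<rightarrow> carrier G \<and> bij_betw (int_comb G c A) (supported_on A) (carrier G)"

context comm_group
begin

lemma int_comb_closed: "c \<in> A \<rightarrow> carrier G \<Longrightarrow> int_comb G c A a \<in> carrier G"
  unfolding int_comb_def by (intro finprod_closed) auto

lemma int_comb_empty: "int_comb G c {} a = \<one>"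
  by (simp add: int_comb_def)

lemma int_comb_insert:
  assumes "finite A" "e \<notin> A" "c \<in> insert e A \<rightarrow> carrier G"
  shows "int_comb G c (insert e A) a = c e [^] a e \<otimes> int_comb G c A a"
  unfolding int_comb_def using assms by (subst finprod_insert) auto

lemma int_comb_cong:
  assumes "\<And>e. e \<in> A \<Longrightarrow> c e = c' e" "\<And>e. e \<in> A \<Longrightarrow> a e = a' e" "c' \<in> A \<rightarrow> carrier G"
  shows "int_comb G c A a = int_comb G c' A a'"
  unfolding int_comb_def using assms by (intro finprod_cong') auto

lemma int_comb_add:
  assumes "c \<in> A \<rightarrow> carrier G"
  shows "int_comb G c A (\<lambda>e. a e + b e) = int_comb G c A a \<otimes> int_comb G c A b"
proof -
  have "int_comb G c A (\<lambda>e. a e + b e) = finprod G (\<lambda>e. c e [^] a e \<otimes> c e [^] b e) A"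
    unfolding int_comb_def using assms
    by (intro finprod_cong') (auto simp: int_pow_mult Pi_iff)
  also have "\<dots> = int_comb G c A a \<otimes> int_comb G c A b"
    unfolding int_comb_def using assms by (intro finprod_multf) auto
  finally show ?thesis .
qed

end

lemma hom_int_comb:
  assumes "comm_group G" "comm_group H" "h \<in> hom G H" "finite A" "c \<in> A \<rightarrow> carrier G"
  shows "h (int_comb G c A a) = int_comb H (h \<circ> c) A a"
proof -
  interpret G: comm_group G by fact
  interpret H: comm_group H by fact
  interpret h: group_hom G H h
    using assms by (simp add: group_hom_def group_hom_axioms_def G.is_group H.is_group)
  show ?thesis
    using assms(4,5)
  proof (induction A)
    case (insert e A)
    then have c: "c e \<in> carrier G" "c \<in> A \<rightarrow> carrier G" "h \<circ> c \<in> insert e A \<rightarrow> carrier H"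
      using h.hom_closed by (auto simp: Pi_iff)
    have "h (int_comb G c (insert e A) a) = h (c e) [^]\<^bsub>H\<^esub> a e \<otimes>\<^bsub>H\<^esub> h (int_comb G c A a)"
      using insert c G.int_comb_closed[OF c(2)] by (simp add: G.int_comb_insert h.hom_int_pow)
    also have "\<dots> = (h \<circ> c) e [^]\<^bsub>H\<^esub> a e \<otimes>\<^bsub>H\<^esub> int_comb H (h \<circ> c) A a"
      using insert.IH[OF c(2)] by (simp add: o_def)
    also have "\<dots> = int_comb H (h \<circ> c) (insert e A) a"
      using H.int_comb_insert[OF insert(1,2) c(3)] by (rule sym)
    finally show ?case .
  qed (simp add: G.int_comb_empty H.int_comb_empty)
qed

lemma supported_on_insert_cases:
  "a \<in> supported_on (insert e A) \<Longrightarrow> a(e := 0) \<in> supported_on A"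
  by (auto simp: supported_on_def)

lemma free_basis_empty:
  fixes c :: "'c \<Rightarrow> 'g"
  assumes "comm_group G" "trivial_group G"
  shows "free_basis G c {}"
proof -
  interpret comm_group G by fact
  have "supported_on {} = {\<lambda>e::'c. 0}" by (auto simp: supported_on_def)
  then show ?thesis
    using assms(2) by (auto simp: free_basis_def bij_betw_def trivial_group_def int_comb_empty)
qed

text \<open>\<open>H\<close> is an extension of the infinite cyclic group \<open>K\<close> by
  \<open>G\<close>. The coefficient at \<open>e\<close> is read off in \<open>K\<close>; what
  remains after removing that part lies in the kernel of \<open>p\<close>, hence comes from
  \<open>G\<close> and has coordinates there.\<close>

lemma free_basis_extend:
  assumes G: "comm_group G" and H: "comm_group H" and K: "comm_group K"
    and i: "i \<in> hom G H" "inj_on i (carrier G)" and p: "p \<in> hom H K"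
    and exact: "kernel H K p = i ` carrier G"
    and A: "finite A" "e \<notin> A"
    and basis: "free_basis G c A"
    and c': "c' e \<in> carrier H" "\<And>f. f \<in> A \<Longrightarrow> c' f = i (c f)"
    and K_basis: "bij_betw (\<lambda>m::int. p (c' e) [^]\<^bsub>K\<^esub> m) UNIV (carrier K)"
  shows "free_basis H c' (insert e A)"
proof -
  interpret G: comm_group G by fact
  interpret H: comm_group H by fact
  interpret K: comm_group K by fact
  interpret i: group_hom G H i
    using assms by (simp add: group_hom_def group_hom_axioms_def G.is_group H.is_group)
  interpret p: group_hom H K p
    using assms by (simp add: group_hom_def group_hom_axioms_def H.is_group K.is_group)
  have c: "c \<in> A \<rightarrow> carrier G" and bij: "bij_betw (int_comb G c A) (supported_on A) (carrier G)"
    using basis by (auto simp: free_basis_def)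
  have c'A: "c' \<in> A \<rightarrow> carrier H" using c c' i.hom_closed by (auto simp: Pi_iff)
  then have c'eA: "c' \<in> insert e A \<rightarrow> carrier H" using c' by auto
  have split: "int_comb H c' (insert e A) a = c' e [^]\<^bsub>H\<^esub> a e \<otimes>\<^bsub>H\<^esub> i (int_comb G c A (a(e := 0)))" for a
  proof -
    have "i (int_comb G c A (a(e := 0))) = int_comb H c' A a"
      using A c c' i.hom_closed unfolding hom_int_comb[OF G H i(1) A(1) c]
      by (intro H.int_comb_cong) (auto simp: Pi_iff)
    then show ?thesis
      using A c'eA by (simp add: H.int_comb_insert)
  qed
  have p_split: "p (int_comb H c' (insert e A) a) = p (c' e) [^]\<^bsub>K\<^esub> a e" for a
  proof -
    have "i (int_comb G c A (a(e := 0))) \<in> kernel H K p"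
      using exact G.int_comb_closed[OF c] by auto
    then show ?thesis
      unfolding split using c' by (simp add: kernel_def p.hom_int_pow)
  qed
  have "inj_on (int_comb H c' (insert e A)) (supported_on (insert e A))"
  proof (rule inj_onI)
    fix a b assume ab: "a \<in> supported_on (insert e A)" "b \<in> supported_on (insert e A)"
      and eq: "int_comb H c' (insert e A) a = int_comb H c' (insert e A) b"
    from eq have "p (c' e) [^]\<^bsub>K\<^esub> a e = p (c' e) [^]\<^bsub>K\<^esub> b e"
      using p_split by metis
    then have e: "a e = b e"
      using K_basis by (auto simp: bij_betw_def inj_on_def)
    have "i (int_comb G c A (a(e := 0))) = i (int_comb G c A (b(e := 0)))"
      using eq e c' G.int_comb_closed[OF c] unfolding split by simp
    then have "int_comb G c A (a(e := 0)) = int_comb G c A (b(e := 0))"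
      using i(2) G.int_comb_closed[OF c] by (auto simp: inj_on_def)
    then have "a(e := 0) = b(e := 0)"
      using bij supported_on_insert_cases[OF ab(1)] supported_on_insert_cases[OF ab(2)]
      by (auto simp: bij_betw_def inj_on_def)
    then show "a = b" using e by (metis fun_upd_triv fun_upd_upd)
  qed
  moreover have "int_comb H c' (insert e A) ` supported_on (insert e A) = carrier H"
  proof
    show "carrier H \<subseteq> int_comb H c' (insert e A) ` supported_on (insert e A)"
    proof
      fix x assume x: "x \<in> carrier H"
      then obtain m :: int where m: "p x = p (c' e) [^]\<^bsub>K\<^esub> m"
        using K_basis p.hom_closed by (force simp: bij_betw_def image_iff)
      let ?y = "inv\<^bsub>H\<^esub> (c' e [^]\<^bsub>H\<^esub> m) \<otimes>\<^bsub>H\<^esub> x"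
      have "?y \<in> kernel H K p"
        using x c' m by (simp add: kernel_def p.hom_int_pow)
      then obtain g where g: "g \<in> carrier G" "?y = i g"
        using exact by auto
      then obtain a where a: "a \<in> supported_on A" "g = int_comb G c A a"
        using bij by (auto simp: bij_betw_def)
      let ?a = "a(e := m)"
      have "a(e := 0) = a" using a A by (auto simp: supported_on_def)
      then have "int_comb H c' (insert e A) ?a = c' e [^]\<^bsub>H\<^esub> m \<otimes>\<^bsub>H\<^esub> i g"
        unfolding split using a by simp
      also have "\<dots> = x"
        unfolding g(2)[symmetric] using c' x by (simp flip: H.m_assoc)
      finally show "x \<in> int_comb H c' (insert e A) ` supported_on (insert e A)"
        using a by (intro image_eqI[of _ _ ?a]) (auto simp: supported_on_def)
    qed
  qed (use H.int_comb_closed[OF c'eA] in auto)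
  ultimately show ?thesis
    using c'eA by (auto simp: free_basis_def bij_betw_def)
qed

subsection \<open>Cellular chains of a finite CW complex\<close>

text \<open>A stage in building the \<open>n\<close>-skeleton from the
  \<open>(n-1)\<close>-skeleton; induction on the finite set \<open>A\<close> attaches the cells one
  at a time.\<close>

definition partial_complex :: "('a, 'c) cell_structure \<Rightarrow> nat \<Rightarrow> 'c set \<Rightarrow> 'a set" where
  "partial_complex S n A = skeleton S (int n - 1) \<union> (\<Union>e\<in>A. open_cell S e)"

lemma facet_subcomplex_eq: "facet_subcomplex S d A = subtopology (cw_space S) (partial_complex S d A)"
  by (simp add: facet_subcomplex_def partial_complex_def)

text \<open>The class of a cell at an intermediate stage; once all \<open>n\<close>-cells are
  present it is \<open>cell_class\<close>.\<close>

definition partial_class ::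
    "('a, 'c) cell_structure \<Rightarrow> nat \<Rightarrow> 'c set \<Rightarrow> 'c \<Rightarrow> 'a chain set" where
  "partial_class S n A e = hom_induced (int n) (disc_top n) (disc_boundary n)
     (facet_subcomplex S n A) (skeleton S (int n - 1)) (char_map S e) (disc_orientation n)"

lemma trivial_group_middle:
  assumes "group G" "trivial_group F" "trivial_group H" "p \<in> hom G H" "kernel G H p = i ` carrier F"
    "i \<in> hom F G"
  shows "trivial_group G"
proof -
  have "kernel G H p = carrier G"
    using assms(3,4) by (auto simp: kernel_def trivial_group_def hom_def)
  moreover have "i ` carrier F = {\<one>\<^bsub>G\<^esub>}"
    using assms by (auto simp: trivial_group_def intro: hom_one)
  ultimately show ?thesis
    using assms by (simp add: trivial_group_def)
qed

locale finite_cw =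
  fixes S :: "('a, 'c) cell_structure"
  assumes finite_cw_complex: "finite_cw_complex S"
begin

abbreviation "X \<equiv> cw_space S"

lemma Hausdorff_X: "Hausdorff_space X"
  and finite_cells: "finite (cells S)"
  and disjoint_cells: "disjoint_family_on (open_cell S) (cells S)"
  and topspace_X: "topspace X = (\<Union>e\<in>cells S. open_cell S e)"
  and continuous_char_map: "e \<in> cells S \<Longrightarrow> continuous_map (disc_top (cell_dim S e)) X (char_map S e)"
  and inj_char_map: "e \<in> cells S \<Longrightarrow> inj_on (char_map S e) (disc_interior (cell_dim S e))"
  and char_map_boundary: "e \<in> cells S \<Longrightarrow>
    char_map S e ` disc_boundary (cell_dim S e) \<subseteq> skeleton S (int (cell_dim S e) - 1)"
  using finite_cw_complex by (auto simp: finite_cw_complex_def)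

lemma finite_n_cells: "finite (n_cells S n)"
  using finite_cells by (simp add: n_cells_def)

lemma skeleton_mono: "k \<le> l \<Longrightarrow> skeleton S k \<subseteq> skeleton S l"
  by (auto simp: skeleton_def)

lemma skeleton_subset_topspace: "skeleton S k \<subseteq> topspace X"
  by (auto simp: skeleton_def topspace_X)

lemma partial_complex_empty: "partial_complex S n {} = skeleton S (int n - 1)"
  by (simp add: partial_complex_def)

lemma partial_complex_n_cells: "partial_complex S n (n_cells S n) = skeleton S (int n)"
  by (force simp: partial_complex_def skeleton_def n_cells_def)

lemma partial_complex_mono: "A \<subseteq> B \<Longrightarrow> partial_complex S n A \<subseteq> partial_complex S n B"
  by (auto simp: partial_complex_def)

lemma skeleton_subset_partial: "skeleton S (int n - 1) \<subseteq> partial_complex S n A"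
  by (auto simp: partial_complex_def)

lemma partial_complex_subset_topspace:
  "A \<subseteq> n_cells S n \<Longrightarrow> partial_complex S n A \<subseteq> topspace X"
  using skeleton_subset_topspace by (auto simp: partial_complex_def topspace_X n_cells_def)

text \<open>The same union can be taken over closed cells, since the boundary of each falls into
  lower cells that are already included. Closed cells are compact, hence closed in a Hausdorff
  space, and there are finitely many.\<close>

lemma closedin_partial_complex:
  assumes "A \<subseteq> n_cells S n"
  shows "closedin X (partial_complex S n A)"
proof -
  let ?B = "{e \<in> cells S. int (cell_dim S e) \<le> int n - 1} \<union> A"
  let ?c = "\<lambda>e. char_map S e ` topspace (disc_top (cell_dim S e))"
  have B: "?B \<subseteq> cells S" using assms by (auto simp: n_cells_def)
  have "partial_complex S n A = (\<Union>e\<in>?B. open_cell S e)"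
    by (auto simp: partial_complex_def skeleton_def)
  also have "\<dots> = (\<Union>e\<in>?B. ?c e)"
  proof
    show "(\<Union>e\<in>?B. open_cell S e) \<subseteq> (\<Union>e\<in>?B. ?c e)"
      using topspace_disc_decomp by (fastforce simp: open_cell_def)
    have "?c e \<subseteq> (\<Union>e\<in>?B. open_cell S e)" if "e \<in> ?B" for e
    proof -
      have "char_map S e ` disc_boundary (cell_dim S e) \<subseteq> skeleton S (int (cell_dim S e) - 1)"
        using that B by (intro char_map_boundary) auto
      also have "\<dots> \<subseteq> skeleton S (int n - 1)"
        using that assms by (intro skeleton_mono) (auto simp: n_cells_def)
      also have "\<dots> \<subseteq> (\<Union>e\<in>?B. open_cell S e)"
        by (auto simp: skeleton_def)
      finally show ?thesis
        unfolding topspace_disc_decomp image_Un using that by (auto simp: open_cell_def)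
    qed
    then show "(\<Union>e\<in>?B. ?c e) \<subseteq> (\<Union>e\<in>?B. open_cell S e)" by blast
  qed
  also have "closedin X (\<Union>e\<in>?B. ?c e)"
  proof (intro closedin_Union)
    show "finite (?c ` ?B)" using B finite_cells by (meson finite_imageI finite_subset)
    fix T assume "T \<in> ?c ` ?B"
    then obtain e where e: "e \<in> cells S" "T = ?c e" using B by auto
    have "compactin (disc_top (cell_dim S e)) (topspace (disc_top (cell_dim S e)))"
      using compact_space_disc by (simp add: compact_space_def)
    then show "closedin X T"
      using e image_compactin continuous_char_map compactin_imp_closedin[OF Hausdorff_X] by blast
  qed
  finally show ?thesis .
qed

lemma topspace_facet_subcomplex:
  "A \<subseteq> n_cells S n \<Longrightarrow> topspace (facet_subcomplex S n A) = partial_complex S n A"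
  using partial_complex_subset_topspace by (auto simp: facet_subcomplex_eq)

lemma subtopology_facet_subcomplex:
  "B \<subseteq> partial_complex S n A \<Longrightarrow> subtopology (facet_subcomplex S n A) B = subtopology X B"
  by (simp add: facet_subcomplex_eq subtopology_subtopology Int_absorb1)

lemma subtopology_facet_subcomplex_mono:
  "A \<subseteq> B \<Longrightarrow> subtopology (facet_subcomplex S n B) (partial_complex S n A) = facet_subcomplex S n A"
  by (simp add: subtopology_facet_subcomplex partial_complex_mono) (simp add: facet_subcomplex_eq)

lemma facet_subcomplex_n_cells: "facet_subcomplex S n (n_cells S n) = skeleton_top S (int n)"
  by (simp add: facet_subcomplex_eq partial_complex_n_cells skeleton_top_def)

lemma subtopology_facet_subcomplex_skeleton:
  "subtopology (facet_subcomplex S n A) (skeleton S (int n - 1)) = skeleton_top S (int n - 1)"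
  by (simp add: subtopology_facet_subcomplex skeleton_subset_partial skeleton_top_def)

lemma continuous_map_facet_subcomplex_id:
  "A \<subseteq> B \<Longrightarrow> continuous_map (facet_subcomplex S n A) (facet_subcomplex S n B) id"
  by (metis continuous_map_from_subtopology continuous_map_id subtopology_facet_subcomplex_mono)

lemma char_map_boundary':
  "e \<in> n_cells S n \<Longrightarrow> char_map S e ` disc_boundary n \<subseteq> skeleton S (int n - 1)"
  using char_map_boundary[of e] by (auto simp: n_cells_def)

lemma continuous_char_map_facet:
  assumes "e \<in> A" "A \<subseteq> n_cells S n"
  shows "continuous_map (disc_top n) (facet_subcomplex S n A) (char_map S e)"
proof -
  have e: "e \<in> cells S" "cell_dim S e = n" using assms by (auto simp: n_cells_def)
  have "char_map S e ` topspace (disc_top n) \<subseteq> partial_complex S n A"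
    unfolding topspace_disc_decomp image_Un
    using char_map_boundary'[of e n] assms e by (auto simp: partial_complex_def open_cell_def)
  then show ?thesis
    using continuous_char_map[OF e(1)] e
    by (auto simp: facet_subcomplex_eq continuous_map_in_subtopology)
qed

lemma cell_attachment_facet:
  assumes "insert e A \<subseteq> n_cells S n" "e \<notin> A"
  shows "cell_attachment n (facet_subcomplex S n (insert e A)) (partial_complex S n A) (char_map S e)"
proof
  have e: "e \<in> cells S" "cell_dim S e = n" using assms by (auto simp: n_cells_def)
  show "Hausdorff_space (facet_subcomplex S n (insert e A))"
    unfolding facet_subcomplex_eq using Hausdorff_X by (rule Hausdorff_space_subtopology)
  show "continuous_map (disc_top n) (facet_subcomplex S n (insert e A)) (char_map S e)"
    using assms by (intro continuous_char_map_facet) auto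
  show "inj_on (char_map S e) (disc_interior n)"
    using inj_char_map[OF e(1)] e by simp
  show "char_map S e ` disc_boundary n \<subseteq> partial_complex S n A"
    using char_map_boundary'[of e n] assms skeleton_subset_partial[of n A] by blast
  show "closedin (facet_subcomplex S n (insert e A)) (partial_complex S n A)"
    unfolding facet_subcomplex_eq using assms
    by (intro closedin_subset_topspace closedin_partial_complex partial_complex_mono) auto
  have "open_cell S e \<inter> open_cell S f = {}" if "f \<in> cells S" "f \<noteq> e" for f
    using disjoint_cells that e by (auto simp: disjoint_family_on_def)
  then show "char_map S e ` disc_interior n \<inter> partial_complex S n A = {}"
    using assms e unfolding partial_complex_def skeleton_def open_cell_def[of S e, symmetric]
    by (fastforce simp: n_cells_def open_cell_def)
  show "topspace (facet_subcomplex S n (insert e A)) = partial_complex S n A \<union> char_map S e ` disc_interior n"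
    using topspace_facet_subcomplex[OF assms(1)] e by (auto simp: partial_complex_def open_cell_def)
qed

lemma hom_induced_partial_class:
  assumes "e \<in> A" "A \<subseteq> B" "B \<subseteq> n_cells S n"
  shows "hom_induced (int n) (facet_subcomplex S n A) (skeleton S (int n - 1))
     (facet_subcomplex S n B) (skeleton S (int n - 1)) id (partial_class S n A e) = partial_class S n B e"
  unfolding partial_class_def using assms
  by (subst hom_induced_compose')
    (use char_map_boundary'[of e n] continuous_char_map_facet[of e A n]
      continuous_map_facet_subcomplex_id[of A B n] in auto)

section \<open>Homology of the stages relative to the lower skeleton\<close>

abbreviation "rel_group n k A \<equiv> relative_homology_group k (facet_subcomplex S n A) (skeleton S (int n - 1))"

text \<open>Induction over the cells, with the exact sequence of the triple of new stage, old stage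
  and lower skeleton. By \<open>iso_char_map\<close> the new stage modulo the old one has the
  homology of the disc modulo its sphere.\<close>

lemma free_basis_partial_class:
  assumes "A \<subseteq> n_cells S n"
  shows "free_basis (rel_group n (int n) A) (partial_class S n A) A
     \<and> (\<forall>k. k \<noteq> int n \<longrightarrow> trivial_group (rel_group n k A))"
  using finite_subset[OF assms finite_n_cells] assms
proof (induction A)
  case empty
  have "trivial_group (rel_group n k {})" for k
    using trivial_relative_homology_group_topspace[of k "facet_subcomplex S n {}"]
    by (simp add: topspace_facet_subcomplex partial_complex_empty)
  then show ?case by (simp add: free_basis_empty)
next
  case (insert e A)
  let ?Y = "facet_subcomplex S n (insert e A)" and ?P = "partial_complex S n A"
    and ?T = "skeleton S (int n - 1)"
  interpret cell_attachment n ?Y ?P "char_map S e"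
    using insert by (intro cell_attachment_facet) auto
  let ?G = "\<lambda>k. rel_group n k A" and ?H = "\<lambda>k. rel_group n k (insert e A)"
    and ?K = "\<lambda>k. relative_homology_group k ?Y ?P"
  let ?i = "\<lambda>k. hom_induced k (facet_subcomplex S n A) ?T ?Y ?T id"
    and ?p = "\<lambda>k. hom_induced k ?Y ?T ?Y ?P id"
  have sub: "?T \<subseteq> ?P" by (rule skeleton_subset_partial)
  have Ysub: "subtopology ?Y ?P = facet_subcomplex S n A"
    by (intro subtopology_facet_subcomplex_mono) auto
  have exact: "kernel (?H k) (?K k) (?p k) = ?i k ` carrier (?G k)" for k
    using homology_exactness_triple_3[OF sub, of k ?Y] by (simp add: Ysub)
  have exact2: "kernel (?G k) (?H k) (?i k) = hom_relboundary (k + 1) ?Y ?P ?T ` carrier (?K (k + 1))" for k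
    using homology_exactness_triple_2[OF sub, of "k + 1" ?Y] by (simp add: Ysub)
  have trivK: "trivial_group (?K k)" if "k \<noteq> int n" for k
  proof -
    have "relative_homology_group k (disc_top n) (disc_boundary n) \<cong> ?K k"
      using iso_char_map[of k] by (auto simp: is_iso_def)
    then show ?thesis
      using isomorphic_group_triviality trivial_homology_disc[OF that]
      by (metis group_relative_homology_group)
  qed
  have IH: "free_basis (?G (int n)) (partial_class S n A) A" "\<And>k. k \<noteq> int n \<Longrightarrow> trivial_group (?G k)"
    using insert by auto
  have "trivial_group (?H k)" if "k \<noteq> int n" for k
    by (rule trivial_group_middle[OF _ IH(2)[OF that] trivK[OF that] _ exact]) (auto simp: hom_induced_hom)
  moreover have "free_basis (?H (int n)) (partial_class S n (insert e A)) (insert e A)"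
  proof (rule free_basis_extend[OF _ _ _ _ _ _ exact insert(1,2) IH(1)])
    show "comm_group (?G (int n))" "comm_group (?H (int n))" "comm_group (?K (int n))" by auto
    show "?i (int n) \<in> hom (?G (int n)) (?H (int n))" "?p (int n) \<in> hom (?H (int n)) (?K (int n))"
      by (rule hom_induced_hom)+
    interpret i: group_hom "?G (int n)" "?H (int n)" "?i (int n)"
      by (simp add: group_hom_def group_hom_axioms_def hom_induced_hom)
    \<comment> \<open>The kernel of \<open>?i\<close> is the image of a boundary map out of degree
      \<open>n + 1\<close> of the attached cell, where the group vanishes.\<close>
    have bd: "hom_relboundary (int n + 1) ?Y ?P ?T \<in> hom (?K (int n + 1)) (?G (int n))"
      using group_homomorphism_hom_relboundary[of "int n + 1" ?Y ?P ?T] by (simp add: Ysub)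
    then have "hom_relboundary (int n + 1) ?Y ?P ?T ` carrier (?K (int n + 1)) = {\<one>\<^bsub>?G (int n)\<^esub>}"
      using trivK[of "int n + 1"] hom_one[OF bd]
      by (simp add: trivial_group_def del: one_relative_homology_group)
    then show "inj_on (?i (int n)) (carrier (?G (int n)))"
      using exact2[of "int n"] by (simp add: i.inj_iff_trivial_ker)
    show "partial_class S n (insert e A) e \<in> carrier (?H (int n))"
      unfolding partial_class_def by (rule hom_induced_carrier)
    show "partial_class S n (insert e A) f = ?i (int n) (partial_class S n A f)" if "f \<in> A" for f
      using hom_induced_partial_class[of f A "insert e A" n] that insert by auto
    let ?\<phi> = "hom_induced (int n) (disc_top n) (disc_boundary n) ?Y ?P (char_map S e)"
    let ?D = "relative_homology_group (int n) (disc_top n) (disc_boundary n)"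
    interpret \<phi>: group_hom ?D "?K (int n)" ?\<phi>
      by (simp add: group_hom_def group_hom_axioms_def hom_induced_hom)
    \<comment> \<open>Modulo the old stage, the class of the new cell is the image of the chosen
      generator under the isomorphism of \<open>iso_char_map\<close>, so each element is exactly one
      power of it.\<close>
    have "?p (int n) (partial_class S n (insert e A) e) = ?\<phi> (disc_orientation n)"
      unfolding partial_class_def using cont char_map_boundary'[of e n] insert.prems sub
      by (subst hom_induced_compose') auto
    then have "(\<lambda>m::int. ?p (int n) (partial_class S n (insert e A) e) [^]\<^bsub>?K (int n)\<^esub> m)
        = ?\<phi> \<circ> (\<lambda>m. disc_orientation n [^]\<^bsub>?D\<^esub> m)"
      using \<phi>.hom_int_pow[OF disc_orientation_closed] by auto
    moreover have "bij_betw ?\<phi> (carrier ?D) (carrier (?K (int n)))"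
      using iso_char_map[of "int n"] by (simp add: iso_def)
    ultimately show "bij_betw (\<lambda>m::int. ?p (int n) (partial_class S n (insert e A) e) [^]\<^bsub>?K (int n)\<^esub> m)
        UNIV (carrier (?K (int n)))"
      using bij_betw_trans[OF bij_disc_orientation] by metis
  qed
  ultimately show ?case by simp
qed

text \<open>The skeleton has dimension \<open>n - 1\<close>, so vanishing starts in degree
  \<open>n\<close>; for \<open>n = 0\<close> it is empty. The induction step uses the pair of
  consecutive skeleta, whose only nonzero relative group sits in degree \<open>n\<close>, below
  \<open>k\<close>.\<close>

lemma trivial_homology_skeleton:
  assumes "n \<le> k"
  shows "trivial_group (homology_group (int k) (skeleton_top S (int n - 1)))"
  using assms
proof (induction n)
  case 0
  have "topspace (skeleton_top S (int 0 - 1)) = {}"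
    by (auto simp: skeleton_top_def skeleton_def)
  then show ?case by (rule trivial_homology_group_empty)
next
  case (Suc n)
  let ?Y = "skeleton_top S (int n)" and ?T = "skeleton S (int n - 1)"
  have T: "subtopology ?Y ?T = skeleton_top S (int n - 1)"
    using subtopology_facet_subcomplex_skeleton[of n "n_cells S n"] by (simp add: facet_subcomplex_n_cells)
  have "trivial_group (relative_homology_group (int k) ?Y ?T)"
    using free_basis_partial_class[of "n_cells S n" n] Suc.prems by (simp add: facet_subcomplex_n_cells)
  moreover have "trivial_group (homology_group (int k) (subtopology ?Y ?T))"
    using Suc T by simp
  moreover have exact: "kernel (homology_group (int k) ?Y) (relative_homology_group (int k) ?Y ?T)
      (hom_induced (int k) ?Y {} ?Y ?T id)
    = hom_induced (int k) (subtopology ?Y ?T) {} ?Y {} id ` carrier (homology_group (int k) (subtopology ?Y ?T))"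
    using homology_exactness_axiom_3[of "int k" ?Y ?T] by simp
  ultimately have "trivial_group (homology_group (int k) ?Y)"
    by (intro trivial_group_middle[OF _ _ _ hom_induced_hom exact hom_induced_hom]) simp_all
  then show ?case by simp
qed

section \<open>Coordinates of cellular chains\<close>

lemma partial_class_n_cells:
  "e \<in> n_cells S n \<Longrightarrow> partial_class S n (n_cells S n) e = cell_class S e"
  unfolding partial_class_def cell_class_def facet_subcomplex_n_cells Let_def
  by (simp add: n_cells_def)

lemma free_basis_cell_class: "free_basis (cellular_chain_group S (int n)) (cell_class S) (n_cells S n)"
proof -
  interpret comm_group "cellular_chain_group S (int n)"
    by (simp add: cellular_chain_group_def)
  have basis: "free_basis (cellular_chain_group S (int n)) (partial_class S n (n_cells S n)) (n_cells S n)"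
    using free_basis_partial_class[of "n_cells S n" n]
    by (simp add: facet_subcomplex_n_cells cellular_chain_group_def)
  then have c: "cell_class S \<in> n_cells S n \<rightarrow> carrier (cellular_chain_group S (int n))"
    by (auto simp: free_basis_def partial_class_n_cells Pi_iff)
  have "int_comb (cellular_chain_group S (int n)) (partial_class S n (n_cells S n)) (n_cells S n)
      = int_comb (cellular_chain_group S (int n)) (cell_class S) (n_cells S n)"
    using c by (intro ext int_comb_cong) (auto simp: partial_class_n_cells)
  then show ?thesis using basis c by (simp add: free_basis_def)
qed

text \<open>Resolves the definite description once and for all: coordinates in a free basis are
  unique.\<close>

lemma cell_coords_eqI:
  assumes "a \<in> supported_on (n_cells S n)"
    "z = int_comb (cellular_chain_group S (int n)) (cell_class S) (n_cells S n) a"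
  shows "cell_coords S n z = a"
  unfolding cell_coords_def int_comb_def[symmetric]
proof (rule the_equality)
  show "(\<forall>e. e \<notin> n_cells S n \<longrightarrow> a e = 0) \<and>
      z = int_comb (cellular_chain_group S (int n)) (cell_class S) (n_cells S n) a"
    using assms by (simp add: supported_on_def)
  fix b assume "(\<forall>e. e \<notin> n_cells S n \<longrightarrow> b e = 0) \<and>
      z = int_comb (cellular_chain_group S (int n)) (cell_class S) (n_cells S n) b"
  then show "b = a"
    using assms free_basis_cell_class[of n]
    by (auto simp: free_basis_def bij_betw_def inj_on_def supported_on_def)
qed

lemma
  assumes "z \<in> carrier (cellular_chain_group S (int n))"
  shows cell_coords_supported: "cell_coords S n z \<in> supported_on (n_cells S n)"
    and int_comb_cell_coords: "int_comb (cellular_chain_group S (int n)) (cell_class S) (n_cells S n)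
      (cell_coords S n z) = z"
proof -
  obtain a where a: "a \<in> supported_on (n_cells S n)"
    "z = int_comb (cellular_chain_group S (int n)) (cell_class S) (n_cells S n) a"
    using assms free_basis_cell_class[of n] unfolding free_basis_def bij_betw_def by blast
  then show "cell_coords S n z \<in> supported_on (n_cells S n)"
    "int_comb (cellular_chain_group S (int n)) (cell_class S) (n_cells S n) (cell_coords S n z) = z"
    using cell_coords_eqI[OF a] by auto
qed

lemma cell_coords_mult:
  assumes "x \<in> carrier (cellular_chain_group S (int n))" "y \<in> carrier (cellular_chain_group S (int n))"
  shows "cell_coords S n (x \<otimes>\<^bsub>cellular_chain_group S (int n)\<^esub> y)
    = (\<lambda>e. cell_coords S n x e + cell_coords S n y e)"
proof (rule cell_coords_eqI)
  interpret comm_group "cellular_chain_group S (int n)"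
    by (simp add: cellular_chain_group_def)
  have "cell_class S \<in> n_cells S n \<rightarrow> carrier (cellular_chain_group S (int n))"
    using free_basis_cell_class[of n] by (simp add: free_basis_def)
  then show "x \<otimes>\<^bsub>cellular_chain_group S (int n)\<^esub> y
    = int_comb (cellular_chain_group S (int n)) (cell_class S) (n_cells S n)
        (\<lambda>e. cell_coords S n x e + cell_coords S n y e)"
    using assms by (simp add: int_comb_add int_comb_cell_coords)
  show "(\<lambda>e. cell_coords S n x e + cell_coords S n y e) \<in> supported_on (n_cells S n)"
    using assms[THEN cell_coords_supported] by (simp add: supported_on_def)
qed


section \<open>Attaching classes and homology one degree below the cells\<close>

definition attaching_class :: "nat \<Rightarrow> 'c \<Rightarrow> 'a chain set" where
  "attaching_class n e =
     hom_boundary (int n) (skeleton_top S (int n)) (skeleton S (int n - 1)) (cell_class S e)"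

text \<open>By naturality of the boundary map, the attaching class, defined in the full
  \<open>n\<close>-skeleton, can be computed in any stage that contains the cell.\<close>

lemma hom_boundary_partial_class:
  assumes "e \<in> A" "A \<subseteq> n_cells S n"
  shows "hom_boundary (int n) (facet_subcomplex S n A) (skeleton S (int n - 1)) (partial_class S n A e)
    = attaching_class n e"
proof -
  let ?T = "skeleton S (int n - 1)" and ?N = "n_cells S n"
  let ?b = "hom_boundary (int n) (facet_subcomplex S n A) ?T (partial_class S n A e)"
  have "attaching_class n e = hom_boundary (int n) (facet_subcomplex S n ?N) ?T (partial_class S n ?N e)"
    using assms partial_class_n_cells[of e n] by (auto simp: attaching_class_def facet_subcomplex_n_cells)
  also have "partial_class S n ?N e = hom_induced (int n) (facet_subcomplex S n A) ?T
      (facet_subcomplex S n ?N) ?T id (partial_class S n A e)"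
    using hom_induced_partial_class[OF assms order_refl] by simp
  also have "hom_boundary (int n) (facet_subcomplex S n ?N) ?T \<dots> =
      hom_induced (int n - 1) (skeleton_top S (int n - 1)) {} (skeleton_top S (int n - 1)) {} id ?b"
  proof -
    have "hom_boundary (int n) (facet_subcomplex S n ?N) ?T
          \<circ> hom_induced (int n) (facet_subcomplex S n A) ?T (facet_subcomplex S n ?N) ?T id
        = hom_induced (int n - 1) (skeleton_top S (int n - 1)) {} (skeleton_top S (int n - 1)) {} id
          \<circ> hom_boundary (int n) (facet_subcomplex S n A) ?T"
      using naturality_hom_induced[OF continuous_map_facet_subcomplex_id[OF assms(2)], where S = ?T and T = ?T]
      by (simp add: subtopology_facet_subcomplex_skeleton)
    from fun_cong[OF this, of "partial_class S n A e"] show ?thesis by simp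
  qed
  also have "\<dots> = ?b"
    using hom_boundary_carrier[of "int n" "facet_subcomplex S n A" ?T]
    by (intro hom_induced_id) (simp add: subtopology_facet_subcomplex_skeleton)
  finally show ?thesis by simp
qed

abbreviation "skel_inc n A \<equiv>
  hom_induced (int n - 1) (skeleton_top S (int n - 1)) {} (facet_subcomplex S n A) {} id"

lemma attaching_class_closed:
  "attaching_class n e \<in> carrier (homology_group (int n - 1) (skeleton_top S (int n - 1)))"
  using hom_boundary_carrier[of "int n" "facet_subcomplex S n (n_cells S n)" "skeleton S (int n - 1)"]
  unfolding subtopology_facet_subcomplex_skeleton by (simp add: attaching_class_def facet_subcomplex_n_cells)

text \<open>Exactness of the pair makes the kernel the image of the relative group in degree
  \<open>n\<close>. That group is spanned by the classes of the cells in \<open>A\<close>, which the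
  boundary map carries to the attaching classes.\<close>

lemma kernel_skel_inc:
  assumes A: "A \<subseteq> n_cells S n"
  defines "Z \<equiv> homology_group (int n - 1) (skeleton_top S (int n - 1))"
  shows "kernel Z (homology_group (int n - 1) (facet_subcomplex S n A)) (skel_inc n A)
    = range (int_comb Z (attaching_class n) A)"
proof -
  let ?Y = "facet_subcomplex S n A" and ?T = "skeleton S (int n - 1)"
  let ?R = "rel_group n (int n) A" and ?bd = "hom_boundary (int n) ?Y ?T" and ?c = "partial_class S n A"
  interpret Z: comm_group Z by (simp add: Z_def)
  interpret R: comm_group ?R by simp
  have fin: "finite A" using A finite_n_cells finite_subset by blast
  have basis: "?c \<in> A \<rightarrow> carrier ?R" "int_comb ?R ?c A ` supported_on A = carrier ?R"
    using free_basis_partial_class[OF A] by (auto simp: free_basis_def bij_betw_def)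
  have bd: "?bd \<in> hom ?R Z"
    using hom_boundary_hom[of "int n" ?Y ?T] by (simp add: subtopology_facet_subcomplex_skeleton Z_def)
  have comb: "int_comb Z (attaching_class n) A a = ?bd (int_comb ?R ?c A a)" for a
  proof -
    have "?bd (int_comb ?R ?c A a) = int_comb Z (?bd \<circ> ?c) A a"
      using hom_int_comb[OF R.comm_group_axioms Z.comm_group_axioms bd fin basis(1)] .
    also have "\<dots> = int_comb Z (attaching_class n) A a"
      using A hom_boundary_partial_class attaching_class_closed
      by (intro Z.int_comb_cong) (auto simp: Z_def)
    finally show ?thesis by simp
  qed
  have "range (int_comb Z (attaching_class n) A) = ?bd ` range (int_comb ?R ?c A)"
    unfolding image_image by (rule image_cong[OF refl comb])
  also have "range (int_comb ?R ?c A) = carrier ?R"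
  proof
    show "range (int_comb ?R ?c A) \<subseteq> carrier ?R"
      using R.int_comb_closed[OF basis(1)] by (rule image_subsetI)
    show "carrier ?R \<subseteq> range (int_comb ?R ?c A)"
      unfolding basis(2)[symmetric] by (rule image_mono[OF subset_UNIV])
  qed
  also have "?bd ` carrier ?R = kernel Z (homology_group (int n - 1) ?Y) (skel_inc n A)"
    using homology_exactness_axiom_2[of "int n" ?Y ?T]
    by (simp add: subtopology_facet_subcomplex_skeleton Z_def)
  finally show ?thesis by simp
qed

text \<open>The relative group in degree \<open>n - 1\<close> vanishes. Together with
  \<open>kernel_skel_inc\<close> this presents the homology of the subcomplex as a quotient of that
  of the skeleton.\<close>

lemma surj_skel_inc:
  assumes "A \<subseteq> n_cells S n"
  shows "skel_inc n A ` carrier (homology_group (int n - 1) (skeleton_top S (int n - 1)))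
    = carrier (homology_group (int n - 1) (facet_subcomplex S n A))"
proof -
  let ?Y = "facet_subcomplex S n A" and ?T = "skeleton S (int n - 1)"
  let ?Q = "homology_group (int n - 1) ?Y" and ?R = "rel_group n (int n - 1) A"
  have "kernel ?Q ?R (hom_induced (int n - 1) ?Y {} ?Y ?T id)
      = skel_inc n A ` carrier (homology_group (int n - 1) (skeleton_top S (int n - 1)))"
    using homology_exactness_axiom_3[of "int n - 1" ?Y ?T]
    by (simp add: subtopology_facet_subcomplex_skeleton)
  moreover have "trivial_group ?R"
    using free_basis_partial_class[OF assms] by simp
  then have "kernel ?Q ?R (hom_induced (int n - 1) ?Y {} ?Y ?T id) = carrier ?Q"
    using hom_induced_carrier[of "int n - 1" ?Y "{}" ?Y ?T id] by (auto simp: kernel_def trivial_group_def)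
  ultimately show ?thesis by simp
qed

lemma hom_induced_skel_inc:
  assumes "A \<subseteq> B"
  shows "hom_induced (int n - 1) (facet_subcomplex S n A) {} (facet_subcomplex S n B) {} id (skel_inc n A x)
    = skel_inc n B x"
proof -
  have "continuous_map (skeleton_top S (int n - 1)) (facet_subcomplex S n A) id"
    using continuous_map_facet_subcomplex_id[of "{}" A n]
    by (simp add: facet_subcomplex_eq partial_complex_empty skeleton_top_def)
  then show ?thesis
    using continuous_map_facet_subcomplex_id[OF assms] by (subst hom_induced_compose') auto
qed

section \<open>Embedding of skeleton homology in integer vectors\<close>

definition skeleton_coords :: "nat \<Rightarrow> 'a chain set \<Rightarrow> 'c \<Rightarrow> int" where
  "skeleton_coords n z = cell_coords S n
     (hom_induced (int n) (skeleton_top S (int n)) {} (skeleton_top S (int n)) (skeleton S (int n - 1)) id z)"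

text \<open>The index is that of the lower dimension: \<open>e\<close> has dimension
  \<open>Suc n\<close>, the rows have dimension \<open>n\<close>.\<close>

lemma incidence_eq_skeleton_coords:
  assumes "e \<in> n_cells S (Suc n)"
  shows "incidence S e (Some f) = skeleton_coords n (attaching_class (Suc n) e) f"
  using assms by (simp add: n_cells_def skeleton_coords_def attaching_class_def cellular_boundary_def)

lemma skeleton_coords_supported: "skeleton_coords n z \<in> supported_on (n_cells S n)"
  unfolding skeleton_coords_def
  by (intro cell_coords_supported) (simp add: cellular_chain_group_def hom_induced_carrier)

lemma skeleton_coords_mult:
  fixes n
  defines "Z \<equiv> homology_group (int n) (skeleton_top S (int n))"
  assumes xy: "x \<in> carrier Z" "y \<in> carrier Z"
  shows "skeleton_coords n (x \<otimes>\<^bsub>Z\<^esub> y) = (\<lambda>e. skeleton_coords n x e + skeleton_coords n y e)"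
proof -
  let ?Y = "skeleton_top S (int n)" and ?T = "skeleton S (int n - 1)"
  let ?j = "hom_induced (int n) ?Y {} ?Y ?T id" and ?C = "cellular_chain_group S (int n)"
  have j: "?j \<in> hom Z ?C"
    unfolding Z_def cellular_chain_group_def by (rule hom_induced_hom)
  have "cell_coords S n (?j x \<otimes>\<^bsub>?C\<^esub> ?j y) = (\<lambda>e. cell_coords S n (?j x) e + cell_coords S n (?j y) e)"
    by (intro cell_coords_mult) (use j xy in \<open>auto simp: hom_def\<close>)
  then show ?thesis
    unfolding skeleton_coords_def using hom_mult[OF j xy] by simp
qed

text \<open>The kernel of the map to relative homology comes from the degree \<open>n\<close>
  homology of the \<open>(n-1)\<close>-skeleton, which is zero, and a cellular chain is determined
  by its coordinates.\<close>

lemma inj_on_skeleton_coords: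
  "inj_on (skeleton_coords n) (carrier (homology_group (int n) (skeleton_top S (int n))))"
proof -
  let ?Y = "skeleton_top S (int n)" and ?T = "skeleton S (int n - 1)"
  let ?j = "hom_induced (int n) ?Y {} ?Y ?T id"
  let ?Z = "homology_group (int n) ?Y" and ?C = "cellular_chain_group S (int n)"
  interpret j: group_hom ?Z ?C ?j
    by (simp add: group_hom_def group_hom_axioms_def hom_induced_hom cellular_chain_group_def)
  have T: "subtopology ?Y ?T = skeleton_top S (int n - 1)"
    using subtopology_facet_subcomplex_skeleton[of n "n_cells S n"] by (simp add: facet_subcomplex_n_cells)
  have "kernel ?Z ?C ?j
      = hom_induced (int n) (skeleton_top S (int n - 1)) {} ?Y {} id
          ` carrier (homology_group (int n) (skeleton_top S (int n - 1)))"
    using homology_exactness_axiom_3[of "int n" ?Y ?T] by (simp add: T cellular_chain_group_def)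
  also have "\<dots> = {\<one>\<^bsub>?Z\<^esub>}"
    using trivial_homology_skeleton[of n n]
      hom_one[OF hom_induced_hom[of "int n" "skeleton_top S (int n - 1)" "{}" ?Y "{}" id]]
    by (simp add: trivial_group_def del: one_relative_homology_group)
  finally have inj: "inj_on ?j (carrier ?Z)"
    by (simp add: j.inj_iff_trivial_ker)
  show ?thesis
  proof (rule inj_onI)
    fix x y assume xy: "x \<in> carrier ?Z" "y \<in> carrier ?Z" "skeleton_coords n x = skeleton_coords n y"
    then have "cell_coords S n (?j x) = cell_coords S n (?j y)"
      by (simp add: skeleton_coords_def)
    moreover have "?j z \<in> carrier ?C" for z
      by (simp add: cellular_chain_group_def hom_induced_carrier)
    ultimately have "?j x = ?j y"
      using int_comb_cell_coords by metis
    then show "x = y" using inj xy by (auto simp: inj_on_def)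
  qed
qed

end

subsection \<open>Integer relations of a circuit\<close>

text \<open>Linear algebra of a circuit with integer columns \<open>\<beta> e\<close>. Dependence
  and minimality are over the reals: a relation that vanishes at one element of \<open>C\<close>
  vanishes at all of them.\<close>

locale integer_circuit =
  fixes C :: "'c set" and R :: "'r set" and \<beta> :: "'c \<Rightarrow> 'r \<Rightarrow> int"
  assumes finite_C: "finite C" and finite_R: "finite R"
    and rows: "\<And>e r. e \<in> C \<Longrightarrow> r \<notin> R \<Longrightarrow> \<beta> e r = 0"
    and dependent: "\<exists>x::'c \<Rightarrow> real. (\<exists>e\<in>C. x e \<noteq> 0) \<and> (\<forall>r. (\<Sum>e\<in>C. x e * \<beta> e r) = 0)"
    and minimal: "\<And>(x::'c \<Rightarrow> real) \<sigma> e. \<lbrakk>\<forall>r. (\<Sum>e\<in>C. x e * \<beta> e r) = 0; \<sigma> \<in> C; x \<sigma> = 0; e \<in> C\<rbrakk> \<Longrightarrow> x e = 0"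
begin

text \<open>Bounds every entry of a combination of columns whose coefficients have absolute value at
  most 1; only finitely many integer vectors lie in the resulting box.\<close>

definition bound :: int where
  "bound = (\<Sum>e\<in>C. \<Sum>r\<in>R. \<bar>\<beta> e r\<bar>)"

definition bounded_vectors :: "('r \<Rightarrow> int) set" where
  "bounded_vectors = {v. \<forall>r. (r \<in> R \<longrightarrow> v r \<in> {- bound..bound}) \<and> (r \<notin> R \<longrightarrow> v r = 0)}"

lemma finite_bounded_vectors: "finite bounded_vectors"
  unfolding bounded_vectors_def by (rule finite_set_of_finite_funs) (auto simp: finite_R)

text \<open>Triangle inequality. It serves both the pigeonhole argument for relations and the
  finiteness of torsion.\<close>

lemma fractional_comb_bounded:
  fixes q :: "'c \<Rightarrow> real"
  assumes "\<And>e. e \<in> A \<Longrightarrow> \<bar>q e\<bar> \<le> 1" "A \<subseteq> C" "\<And>r. real_of_int (v r) = (\<Sum>e\<in>A. q e * \<beta> e r)"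
  shows "v \<in> bounded_vectors"
proof -
  have "v r = 0" if "r \<notin> R" for r
  proof -
    have "real_of_int (v r) = (\<Sum>e\<in>A. q e * \<beta> e r)" by fact
    also have "\<dots> = 0" using that assms(2) rows by (intro sum.neutral) auto
    finally show ?thesis by simp
  qed
  moreover have "\<bar>v r\<bar> \<le> bound" if "r \<in> R" for r
  proof -
    have "real_of_int \<bar>v r\<bar> = \<bar>\<Sum>e\<in>A. q e * \<beta> e r\<bar>" by (simp flip: assms(3))
    also have "\<dots> \<le> (\<Sum>e\<in>A. \<bar>q e * \<beta> e r\<bar>)" by (rule sum_abs)
    also have "\<dots> \<le> (\<Sum>e\<in>A. \<bar>real_of_int (\<beta> e r)\<bar>)"
      using assms(1) by (intro sum_mono) (simp add: abs_mult mult_left_le_one_le)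
    also have "\<dots> \<le> (\<Sum>e\<in>C. \<bar>real_of_int (\<beta> e r)\<bar>)"
      using assms(2) finite_C by (intro sum_mono2) auto
    also have "\<dots> \<le> (\<Sum>e\<in>C. \<Sum>r\<in>R. \<bar>real_of_int (\<beta> e r)\<bar>)"
      using that finite_R by (intro sum_mono member_le_sum) auto
    also have "\<dots> = real_of_int bound" by (simp add: bound_def)
    finally show ?thesis by linarith
  qed
  ultimately show ?thesis by (auto simp: bounded_vectors_def abs_le_iff minus_le_iff)
qed

definition relation :: "('c \<Rightarrow> int) \<Rightarrow> bool" where
  "relation a \<longleftrightarrow> a \<in> supported_on C \<and> (\<forall>r. (\<Sum>e\<in>C. a e * \<beta> e r) = 0)"

lemma relation_add: "relation a \<Longrightarrow> relation b \<Longrightarrow> relation (\<lambda>e. a e + b e)"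
  by (auto simp: relation_def supported_on_def distrib_right sum.distrib)

lemma relation_scale: "relation a \<Longrightarrow> relation (\<lambda>e. m * a e)"
  by (auto simp: relation_def supported_on_def mult.assoc simp flip: sum_distrib_left)

lemma relation_eq_0:
  assumes a: "relation a" and \<sigma>: "\<sigma> \<in> C" "a \<sigma> = 0"
  shows "a = (\<lambda>e. 0)"
proof
  fix e
  have "real_of_int (\<Sum>e\<in>C. a e * \<beta> e r) = 0" for r
    using a by (simp add: relation_def)
  then have "(\<Sum>e\<in>C. real_of_int (a e) * real_of_int (\<beta> e r)) = 0" for r by simp
  then have "real_of_int (a e) = 0" if "e \<in> C"
    using minimal[of "\<lambda>e. real_of_int (a e)" \<sigma> e] \<sigma> that by simp
  then show "a e = 0"
    using a by (cases "e \<in> C") (auto simp: relation_def supported_on_def)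
qed

text \<open>
  The multiples \<open>n x\<close> of a real relation, rounded down, give infinitely many integer combinations
  of the columns in a bounded region; two of them coincide.
\<close>
lemma exists_integer_relation: "\<exists>a. relation a \<and> (\<exists>e. a e \<noteq> 0)"
proof -
  obtain x :: "'c \<Rightarrow> real" and \<sigma> where \<sigma>: "\<sigma> \<in> C" "x \<sigma> \<noteq> 0"
    and x: "\<And>r. (\<Sum>e\<in>C. x e * \<beta> e r) = 0"
    using dependent by blast
  \<comment> \<open>Normalised so that \<open>q \<sigma> = 1\<close>; the coefficient of
    \<open>a\<close> at \<open>\<sigma>\<close> is then \<open>n - n'\<close>, which is
    nonzero.\<close>
  define q where "q e = x e / x \<sigma>" for e
  have q: "(\<Sum>e\<in>C. q e * \<beta> e r) = 0" for r
  proof -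
    have "(\<Sum>e\<in>C. q e * \<beta> e r) = (\<Sum>e\<in>C. x e * \<beta> e r) / x \<sigma>"
      by (simp add: q_def sum_divide_distrib)
    then show ?thesis by (simp add: x)
  qed
  define v where "v n r = (\<Sum>e\<in>C. \<lfloor>real n * q e\<rfloor> * \<beta> e r)" for n :: nat and r
  have "v n \<in> bounded_vectors" for n
  proof (rule fractional_comb_bounded[of C "\<lambda>e. - frac (real n * q e)"])
    fix r
    have "(\<Sum>e\<in>C. - frac (real n * q e) * \<beta> e r)
        = (\<Sum>e\<in>C. \<lfloor>real n * q e\<rfloor> * \<beta> e r - real n * (q e * \<beta> e r))"
      by (intro sum.cong) (auto simp: frac_def algebra_simps)
    also have "\<dots> = real_of_int (v n r) - real n * (\<Sum>e\<in>C. q e * \<beta> e r)"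
      by (simp add: v_def sum_subtractf sum_distrib_left)
    finally show "real_of_int (v n r) = (\<Sum>e\<in>C. - frac (real n * q e) * \<beta> e r)"
      by (simp add: q)
  qed (auto simp: frac_ge_0 less_imp_le frac_lt_1)
  then have "range v \<subseteq> bounded_vectors" by blast
  then have "finite (range v)" using finite_bounded_vectors finite_subset by blast
  then have "\<not> inj v" using finite_imageD infinite_UNIV_nat by blast
  then obtain n n' where n: "n \<noteq> n'" "v n = v n'" by (auto simp: inj_def)
  define a where "a e = (if e \<in> C then \<lfloor>real n * q e\<rfloor> - \<lfloor>real n' * q e\<rfloor> else 0)" for e
  have "(\<Sum>e\<in>C. a e * \<beta> e r) = v n r - v n' r" for r
    by (simp add: a_def v_def sum_subtractf algebra_simps)
  then have "relation a" using n by (auto simp: relation_def supported_on_def a_def)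
  moreover have "a \<sigma> \<noteq> 0" using \<sigma> n by (simp add: a_def q_def)
  ultimately show ?thesis by blast
qed

text \<open>A relation is determined by its value at a fixed \<open>\<sigma>\<close>, and these
  values form a subgroup of the integers. A relation with least positive value generates all others,
  by division with remainder.\<close>

lemma exists_generating_relation:
  "\<exists>l. relation l \<and> (\<forall>e\<in>C. l e \<noteq> 0) \<and> (\<forall>a. relation a \<longrightarrow> (\<exists>m. a = (\<lambda>e. m * l e)))"
proof -
  obtain a0 where a0: "relation a0" "\<exists>e. a0 e \<noteq> 0"
    using exists_integer_relation by blast
  then obtain \<sigma> where \<sigma>: "\<sigma> \<in> C" "a0 \<sigma> \<noteq> 0"
    by (auto simp: relation_def supported_on_def)
  let ?P = "\<lambda>n. n > 0 \<and> (\<exists>a. relation a \<and> a \<sigma> = int n)"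
  have "\<exists>n. ?P n"
  proof (intro exI[of _ "nat \<bar>a0 \<sigma>\<bar>"] conjI exI[of _ "\<lambda>e. sgn (a0 \<sigma>) * a0 e"])
    show "sgn (a0 \<sigma>) * a0 \<sigma> = int (nat \<bar>a0 \<sigma>\<bar>)"
      by (metis abs_ge_zero int_nat_eq abs_sgn mult.commute)
  qed (use \<sigma> relation_scale[OF a0(1)] in auto)
  then obtain n where n: "?P n" and least: "\<And>k. ?P k \<Longrightarrow> n \<le> k"
    using LeastI_ex[of ?P] Least_le[of ?P] by blast
  obtain l where l: "relation l" "l \<sigma> = int n" using n by blast
  have "l e \<noteq> 0" if "e \<in> C" for e
    using relation_eq_0[OF l(1) that] l n by (metis of_nat_0_less_iff less_irrefl)
  moreover have "\<exists>m. a = (\<lambda>e. m * l e)" if a: "relation a" for a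
  proof -
    let ?m = "a \<sigma> div int n"
    let ?b = "\<lambda>e. a e + (- ?m) * l e"
    have b: "relation ?b"
      by (rule relation_add[OF a relation_scale[OF l(1)]])
    have b\<sigma>: "?b \<sigma> = a \<sigma> mod int n" by (simp add: l minus_mult_div_eq_mod mult.commute)
    have "?b \<sigma> = 0"
    proof (rule ccontr)
      assume "?b \<sigma> \<noteq> 0"
      then have "0 < ?b \<sigma>" "?b \<sigma> < int n"
        using n pos_mod_bound[of "int n" "a \<sigma>"] pos_mod_sign[of "int n" "a \<sigma>"] b\<sigma> by linarith+
      then have "?P (nat (?b \<sigma>))" using b by (intro conjI exI[of _ ?b]) auto
      then have "n \<le> nat (?b \<sigma>)" by (rule least)
      moreover have "nat (?b \<sigma>) < n"
        using \<open>0 < ?b \<sigma>\<close> \<open>?b \<sigma> < int n\<close> by (subst nat_less_iff) auto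
      ultimately show False by (meson leD)
    qed
    then have b0: "?b = (\<lambda>e. 0)" by (rule relation_eq_0[OF b \<sigma>(1)])
    have "a e = ?m * l e" for e using fun_cong[OF b0, of e] by linarith
    then show ?thesis by (intro exI[of _ ?m] ext)
  qed
  ultimately show ?thesis using l by blast
qed

text \<open>Subtracting the multiple of \<open>l\<close> that cancels the coordinate at one
  \<open>\<sigma>\<close> leaves a relation that minimality forces to be zero.\<close>

lemma real_relation_multiple:
  fixes x :: "'c \<Rightarrow> real"
  assumes "relation l" "\<And>e. e \<in> C \<Longrightarrow> l e \<noteq> 0" "\<forall>r. (\<Sum>e\<in>C. x e * \<beta> e r) = 0" "C \<noteq> {}"
  shows "\<exists>t::real. \<forall>e\<in>C. x e = t * real_of_int (l e)"
proof -
  obtain \<sigma> where \<sigma>: "\<sigma> \<in> C" using assms(4) by blast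
  let ?t = "x \<sigma> / l \<sigma>"
  have "(\<Sum>e\<in>C. (x e - ?t * l e) * \<beta> e r) = 0" for r
  proof -
    have "real_of_int (\<Sum>e\<in>C. l e * \<beta> e r) = 0"
      using assms(1) by (simp add: relation_def)
    then have l0: "(\<Sum>e\<in>C. real_of_int (l e) * real_of_int (\<beta> e r)) = 0" by simp
    have "(\<Sum>e\<in>C. (x e - ?t * l e) * \<beta> e r)
        = (\<Sum>e\<in>C. x e * \<beta> e r) - ?t * (\<Sum>e\<in>C. real_of_int (l e) * real_of_int (\<beta> e r))"
      by (simp add: left_diff_distrib sum_subtractf sum_distrib_left mult.assoc)
    then show ?thesis using assms(3) l0 by simp
  qed
  then have "x e - ?t * l e = 0" if "e \<in> C" for e
    using minimal[of "\<lambda>e. x e - ?t * l e" \<sigma> e] \<sigma> assms(2)[OF \<sigma>] that by simp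
  then show ?thesis by (intro exI[of _ ?t]) auto
qed

end

subsection \<open>Torsion of quotients by circuits\<close>

lemma int_comb_integer_group:
  assumes "finite A"
  shows "int_comb integer_group c A a = (\<Sum>e\<in>A. a e * c e)"
proof -
  interpret comm_group integer_group
    by (rule abelian_integer_group)
  show ?thesis
    using assms by (induction A) (auto simp: int_comb_empty int_comb_insert)
qed


text \<open>\<open>Q A\<close> is the quotient of \<open>Z\<close> by the \<open>b e\<close> with
  \<open>e\<close> in \<open>A\<close>, given only up to isomorphism by the surjection
  \<open>i A\<close> and its kernel, so that homology groups fit directly. \<open>\<kappa>\<close>
  embeds \<open>Z\<close> in integer vectors, and \<open>f A\<close> is the projection to
  \<open>Q C\<close>.\<close>

locale circuit_groups = integer_circuit C R \<beta> for C :: "'c set" and R :: "'r set" and \<beta> +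
  fixes Z :: "('z, 'm) monoid_scheme" and \<kappa> :: "'z \<Rightarrow> 'r \<Rightarrow> int" and b :: "'c \<Rightarrow> 'z"
    and Q :: "'c set \<Rightarrow> ('q, 'n) monoid_scheme" and i :: "'c set \<Rightarrow> 'z \<Rightarrow> 'q"
    and f :: "'c set \<Rightarrow> 'q \<Rightarrow> 'q"
  assumes Z: "comm_group Z" and Q: "\<And>A. A \<subseteq> C \<Longrightarrow> comm_group (Q A)"
    and b_closed: "\<And>e. e \<in> C \<Longrightarrow> b e \<in> carrier Z"
    and \<kappa>_mult: "\<And>x y r. \<lbrakk>x \<in> carrier Z; y \<in> carrier Z\<rbrakk> \<Longrightarrow> \<kappa> (x \<otimes>\<^bsub>Z\<^esub> y) r = \<kappa> x r + \<kappa> y r"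
    and \<kappa>_inj: "inj_on \<kappa> (carrier Z)"
    and \<kappa>_b: "\<And>e. e \<in> C \<Longrightarrow> \<kappa> (b e) = \<beta> e"
    and i_hom: "\<And>A. A \<subseteq> C \<Longrightarrow> i A \<in> hom Z (Q A)"
    and i_surj: "\<And>A. A \<subseteq> C \<Longrightarrow> i A ` carrier Z = carrier (Q A)"
    and i_kernel: "\<And>A. A \<subseteq> C \<Longrightarrow> kernel Z (Q A) (i A) = range (int_comb Z b A)"
    and f_hom: "\<And>A. A \<subseteq> C \<Longrightarrow> f A \<in> hom (Q A) (Q C)"
    and f_i: "\<And>A x. \<lbrakk>A \<subseteq> C; x \<in> carrier Z\<rbrakk> \<Longrightarrow> f A (i A x) = i C x"
begin

sublocale Z: comm_group Z by (rule Z)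

lemma i_group_hom: "A \<subseteq> C \<Longrightarrow> group_hom Z (Q A) (i A)"
  using i_hom Q by (simp add: group_hom_def group_hom_axioms_def Z.is_group comm_group.axioms(2))

lemma \<kappa>_group_hom: "group_hom Z integer_group (\<lambda>z. \<kappa> z r)"
  using \<kappa>_mult by (simp add: group_hom_def group_hom_axioms_def Z.is_group hom_def)

lemma \<kappa>_int_comb:
  assumes "A \<subseteq> C"
  shows "\<kappa> (int_comb Z b A a) r = (\<Sum>e\<in>A. a e * \<beta> e r)"
proof -
  have A: "finite A" "b \<in> A \<rightarrow> carrier Z" using assms finite_C finite_subset b_closed by auto
  have "\<kappa> (int_comb Z b A a) r = int_comb integer_group ((\<lambda>z. \<kappa> z r) \<circ> b) A a"
    using hom_int_comb[OF Z abelian_integer_group _ A] group_hom.homh[OF \<kappa>_group_hom] by blast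
  also have "\<dots> = (\<Sum>e\<in>A. a e * \<beta> e r)"
    using assms A by (auto simp: int_comb_integer_group \<kappa>_b intro!: sum.cong)
  finally show ?thesis .
qed

lemma \<kappa>_pow: "x \<in> carrier Z \<Longrightarrow> \<kappa> (x [^]\<^bsub>Z\<^esub> (m::int)) r = m * \<kappa> x r"
  using group_hom.hom_int_pow[OF \<kappa>_group_hom, of x m r] by simp

lemma \<kappa>_one: "\<kappa> \<one>\<^bsub>Z\<^esub> r = 0"
  using group_hom.hom_one[OF \<kappa>_group_hom, of r] by simp

text \<open>Relations between columns lift to \<open>Z\<close> because \<open>\<kappa>\<close> is
  injective.\<close>

lemma int_comb_relation: "relation a \<Longrightarrow> int_comb Z b C a = \<one>\<^bsub>Z\<^esub>"
  using \<kappa>_inj Z.int_comb_closed[of b C a] b_closed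
  by (auto simp: inj_on_def fun_eq_iff \<kappa>_int_comb \<kappa>_one relation_def)

lemma int_comb_split:
  assumes "\<sigma> \<in> C"
  shows "int_comb Z b C a = b \<sigma> [^]\<^bsub>Z\<^esub> a \<sigma> \<otimes>\<^bsub>Z\<^esub> int_comb Z b (C - {\<sigma>}) a"
  using Z.int_comb_insert[of "C - {\<sigma>}" \<sigma> b a] assms finite_C b_closed by (auto simp: insert_absorb)

lemma i_int_comb: "A \<subseteq> C \<Longrightarrow> i A (int_comb Z b A a) = \<one>\<^bsub>Q A\<^esub>"
  using i_kernel[of A] by (auto simp: kernel_def)

text \<open>
  Subtracting integer parts of the coefficients, every torsion class gets a representative whose
  image in the free group is a combination of the columns with coefficients in \<open>[0, 1)\<close>.
\<close>
lemma finite_torsion: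
  assumes A: "A \<subseteq> C"
  shows "finite (torsion_elements (Q A))"
proof -
  interpret Q: comm_group "Q A" using Q[OF A] .
  interpret i: group_hom Z "Q A" "i A" using i_group_hom[OF A] .
  have bA: "b \<in> A \<rightarrow> carrier Z" using A b_closed by auto
  have fin: "finite {z \<in> carrier Z. \<kappa> z \<in> bounded_vectors}"
  proof (rule finite_imageD[of \<kappa>])
    show "finite (\<kappa> ` {z \<in> carrier Z. \<kappa> z \<in> bounded_vectors})"
      using finite_bounded_vectors by (rule finite_subset[rotated]) auto
    show "inj_on \<kappa> {z \<in> carrier Z. \<kappa> z \<in> bounded_vectors}"
      using \<kappa>_inj by (rule inj_on_subset) auto
  qed
  have "torsion_elements (Q A) \<subseteq> i A ` {z \<in> carrier Z. \<kappa> z \<in> bounded_vectors}"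
  proof
    fix x assume "x \<in> torsion_elements (Q A)"
    then obtain n :: nat where x: "x \<in> carrier (Q A)" "n > 0" "x [^]\<^bsub>Q A\<^esub> n = \<one>\<^bsub>Q A\<^esub>"
      by (auto simp: torsion_elements_def)
    then obtain z where z: "z \<in> carrier Z" "x = i A z" using i_surj[OF A] by auto
    have "z [^]\<^bsub>Z\<^esub> n \<in> kernel Z (Q A) (i A)"
      using x z by (simp add: kernel_def i.hom_nat_pow)
    then obtain a where a: "z [^]\<^bsub>Z\<^esub> n = int_comb Z b A a" using i_kernel[OF A] by auto
    define q where "q e = a e / real n" for e
    let ?w = "int_comb Z b A (\<lambda>e. - \<lfloor>q e\<rfloor>)"
    let ?z = "z \<otimes>\<^bsub>Z\<^esub> ?w"
    have w: "?w \<in> carrier Z" using Z.int_comb_closed[OF bA] .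
    have zr: "real_of_int (\<kappa> z r) = (\<Sum>e\<in>A. q e * \<beta> e r)" for r
    proof -
      have "int n * \<kappa> z r = (\<Sum>e\<in>A. a e * \<beta> e r)"
        using \<kappa>_pow[OF z(1), of "int n" r] a \<kappa>_int_comb[OF A] by (simp add: int_pow_int)
      then have "real n * real_of_int (\<kappa> z r) = (\<Sum>e\<in>A. a e * \<beta> e r)"
        by (metis of_int_mult of_int_of_nat_eq)
      then show ?thesis using x(2) by (simp add: q_def field_simps flip: sum_divide_distrib)
    qed
    have "\<kappa> ?z \<in> bounded_vectors"
    proof (rule fractional_comb_bounded[OF _ A])
      fix r
      have "real_of_int (\<kappa> ?z r) = (\<Sum>e\<in>A. q e * \<beta> e r) - (\<Sum>e\<in>A. \<lfloor>q e\<rfloor> * \<beta> e r)"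
        using z w by (simp add: \<kappa>_mult zr \<kappa>_int_comb[OF A] sum_negf)
      also have "\<dots> = (\<Sum>e\<in>A. frac (q e) * \<beta> e r)"
        by (simp add: frac_def left_diff_distrib sum_subtractf)
      finally show "real_of_int (\<kappa> ?z r) = (\<Sum>e\<in>A. frac (q e) * \<beta> e r)" .
    qed (auto simp: frac_ge_0 less_imp_le frac_lt_1)
    moreover have "i A ?z = x" using z w x i_int_comb[OF A] by simp
    ultimately show "x \<in> i A ` {z \<in> carrier Z. \<kappa> z \<in> bounded_vectors}"
      using z w by (intro image_eqI[of _ _ ?z]) auto
  qed
  then show ?thesis using fin finite_subset by blast
qed

text \<open>Torsion is counted along the projection from \<open>Q (C - {\<sigma>})\<close> to
  \<open>Q C\<close>: its kernel is cyclic of order \<open>\<bar>l \<sigma>\<bar>\<close>, and all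
  fibres over torsion elements are translates of that kernel.\<close>

lemma card_torsion_facet:
  assumes \<sigma>: "\<sigma> \<in> C" and l: "relation l" "l \<sigma> \<noteq> 0"
    and gen: "\<And>a. relation a \<Longrightarrow> \<exists>m. a = (\<lambda>e. m * l e)"
  shows "card (torsion_elements (Q (C - {\<sigma>}))) = nat \<bar>l \<sigma>\<bar> * card (torsion_elements (Q C))"
proof -
  define A where "A = C - {\<sigma>}"
  have A: "A \<subseteq> C" by (auto simp: A_def)
  have bA: "b \<in> A \<rightarrow> carrier Z" using A b_closed by auto
  interpret QA: comm_group "Q A" using Q[OF A] .
  interpret QC: comm_group "Q C" using Q[OF order_refl] .
  interpret iA: group_hom Z "Q A" "i A" using i_group_hom[OF A] .
  interpret iC: group_hom Z "Q C" "i C" using i_group_hom[OF order_refl] .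
  interpret f: group_hom "Q A" "Q C" "f A"
    using f_hom[OF A] by (simp add: group_hom_def group_hom_axioms_def QA.is_group QC.is_group)
  define g where "g = i A (b \<sigma>)"
  have g: "g \<in> carrier (Q A)" using b_closed[OF \<sigma>] by (simp add: g_def)
  \<comment> \<open>Modulo the other elements of \<open>C\<close> only the contribution of
    \<open>\<sigma>\<close> survives.\<close>
  have i_comb: "i A (int_comb Z b C a) = g [^]\<^bsub>Q A\<^esub> a \<sigma>" for a
  proof -
    have "i A (int_comb Z b C a) = i A (b \<sigma>) [^]\<^bsub>Q A\<^esub> a \<sigma> \<otimes>\<^bsub>Q A\<^esub> i A (int_comb Z b A a)"
      using int_comb_split[OF \<sigma>, of a] b_closed[OF \<sigma>] Z.int_comb_closed[OF bA]
      by (simp add: A_def[symmetric] iA.hom_int_pow)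
    then show ?thesis using i_int_comb[OF A] g by (simp add: g_def)
  qed
  \<comment> \<open>An element killed in \<open>Q C\<close> is represented by a combination over
    \<open>C\<close>, which \<open>i_comb\<close> turns into a power of \<open>g\<close>.\<close>
  have ker: "{x \<in> carrier (Q A). f A x = \<one>\<^bsub>Q C\<^esub>} = range (\<lambda>k::int. g [^]\<^bsub>Q A\<^esub> k)"
  proof (intro equalityI subsetI)
    fix x assume x: "x \<in> {x \<in> carrier (Q A). f A x = \<one>\<^bsub>Q C\<^esub>}"
    then obtain z where z: "z \<in> carrier Z" "x = i A z" using i_surj[OF A] by auto
    then have "z \<in> kernel Z (Q C) (i C)" using x f_i[OF A] by (simp add: kernel_def)
    then obtain a where "z = int_comb Z b C a" using i_kernel[of C] by auto
    then show "x \<in> range (\<lambda>k::int. g [^]\<^bsub>Q A\<^esub> k)" using z i_comb by auto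
  next
    fix x assume "x \<in> range (\<lambda>k::int. g [^]\<^bsub>Q A\<^esub> k)"
    then obtain k :: int where k: "x = g [^]\<^bsub>Q A\<^esub> k" by auto
    let ?z = "int_comb Z b C (\<lambda>e. if e = \<sigma> then k else 0)"
    have "?z \<in> carrier Z" by (intro Z.int_comb_closed) (auto simp: b_closed)
    then have "f A (i A ?z) = \<one>\<^bsub>Q C\<^esub>" using f_i[OF A] i_int_comb[of C] by simp
    then show "x \<in> {x \<in> carrier (Q A). f A x = \<one>\<^bsub>Q C\<^esub>}"
      using i_comb[of "\<lambda>e. if e = \<sigma> then k else 0"] k g by simp
  qed
  \<comment> \<open>The order of \<open>g\<close>: a power of \<open>b \<sigma>\<close> expressed
    through the other classes is a relation, hence a multiple of \<open>l\<close>; conversely,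
    multiples of \<open>l\<close> lift to trivial combinations in \<open>Z\<close>.\<close>
  have g_pow: "g [^]\<^bsub>Q A\<^esub> k = \<one>\<^bsub>Q A\<^esub> \<longleftrightarrow> l \<sigma> dvd k" for k :: int
  proof
    assume "l \<sigma> dvd k"
    then obtain m where "k = m * l \<sigma>" by (metis dvdE mult.commute)
    then show "g [^]\<^bsub>Q A\<^esub> k = \<one>\<^bsub>Q A\<^esub>"
      using i_comb[of "\<lambda>e. m * l e"] int_comb_relation[OF relation_scale[OF l(1)]] by simp
  next
    assume "g [^]\<^bsub>Q A\<^esub> k = \<one>\<^bsub>Q A\<^esub>"
    then have "b \<sigma> [^]\<^bsub>Z\<^esub> k \<in> kernel Z (Q A) (i A)"
      using b_closed[OF \<sigma>] by (simp add: kernel_def g_def iA.hom_int_pow)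
    then obtain a where a: "b \<sigma> [^]\<^bsub>Z\<^esub> k = int_comb Z b A a" using i_kernel[OF A] by auto
    \<comment> \<open>The equation moved to one side, which puts \<open>- k\<close> at
      \<open>\<sigma>\<close>.\<close>
    let ?a = "\<lambda>e. if e = \<sigma> then - k else if e \<in> A then a e else 0"
    have "relation ?a"
      unfolding relation_def
    proof (intro conjI allI)
      show "?a \<in> supported_on C" using \<sigma> by (auto simp: supported_on_def A_def)
      fix r
      have "k * \<beta> \<sigma> r = (\<Sum>e\<in>A. a e * \<beta> e r)"
        using \<kappa>_pow[OF b_closed[OF \<sigma>], of k r] a \<kappa>_int_comb[OF A] \<kappa>_b[OF \<sigma>] by simp
      moreover have "(\<Sum>e\<in>C. ?a e * \<beta> e r) = - k * \<beta> \<sigma> r + (\<Sum>e\<in>A. ?a e * \<beta> e r)"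
        using \<sigma> finite_C by (simp add: sum.remove[of C \<sigma>] A_def)
      moreover have "(\<Sum>e\<in>A. ?a e * \<beta> e r) = (\<Sum>e\<in>A. a e * \<beta> e r)"
        by (intro sum.cong) (auto simp: A_def)
      ultimately show "(\<Sum>e\<in>C. ?a e * \<beta> e r) = 0" by simp
    qed
    then obtain m where "?a = (\<lambda>e. m * l e)" using gen by blast
    then have "?a \<sigma> = m * l \<sigma>" by (rule fun_cong)
    then have "- k = m * l \<sigma>" by simp
    then show "l \<sigma> dvd k" by (metis dvd_minus_iff dvd_triv_right)
  qed
  have card_ker: "card {x \<in> carrier (Q A). f A x = \<one>\<^bsub>Q C\<^esub>} = nat \<bar>l \<sigma>\<bar>"
  proof -
    have "bij_betw (\<lambda>k::int. g [^]\<^bsub>Q A\<^esub> k) {0..<\<bar>l \<sigma>\<bar>} (range (\<lambda>k::int. g [^]\<^bsub>Q A\<^esub> k))"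
      unfolding bij_betw_def
    proof
      have eq: "g [^]\<^bsub>Q A\<^esub> j = g [^]\<^bsub>Q A\<^esub> k \<longleftrightarrow> l \<sigma> dvd (j - k)" for j k :: int
        using g_pow[of "j - k"] g by (simp add: QA.int_pow_diff QA.inv_solve_right')
      show "inj_on (\<lambda>k::int. g [^]\<^bsub>Q A\<^esub> k) {0..<\<bar>l \<sigma>\<bar>}"
      proof (rule inj_onI)
        fix j k assume jk: "j \<in> {0..<\<bar>l \<sigma>\<bar>}" "k \<in> {0..<\<bar>l \<sigma>\<bar>}" "g [^]\<^bsub>Q A\<^esub> j = g [^]\<^bsub>Q A\<^esub> k"
        then have "\<bar>l \<sigma>\<bar> dvd j - k" using eq by simp
        then have "j mod \<bar>l \<sigma>\<bar> = k mod \<bar>l \<sigma>\<bar>" by (simp add: mod_eq_dvd_iff)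
        then show "j = k" using jk by simp
      qed
      show "(\<lambda>k::int. g [^]\<^bsub>Q A\<^esub> k) ` {0..<\<bar>l \<sigma>\<bar>} = range (\<lambda>k::int. g [^]\<^bsub>Q A\<^esub> k)"
      proof (intro subset_antisym[OF image_mono[OF subset_UNIV] subsetI])
        fix x assume "x \<in> range (\<lambda>k::int. g [^]\<^bsub>Q A\<^esub> k)"
        then obtain k :: int where k: "x = g [^]\<^bsub>Q A\<^esub> k" by auto
        have "l \<sigma> dvd k - k mod \<bar>l \<sigma>\<bar>" by (metis abs_dvd_iff dvd_minus_mod)
        then have "x = g [^]\<^bsub>Q A\<^esub> (k mod \<bar>l \<sigma>\<bar>)" using eq k by simp
        then show "x \<in> (\<lambda>k::int. g [^]\<^bsub>Q A\<^esub> k) ` {0..<\<bar>l \<sigma>\<bar>}"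
          using l(2) by (intro image_eqI[of _ _ "k mod \<bar>l \<sigma>\<bar>"]) auto
      qed
    qed
    then show ?thesis unfolding ker using bij_betw_same_card by fastforce
  qed
  have surj: "f A ` carrier (Q A) = carrier (Q C)"
    using i_surj[OF A, symmetric] i_surj[of C, symmetric] f_i[OF A] by (simp add: image_image)
  have torsion: "torsion_elements (Q A) = {x \<in> carrier (Q A). f A x \<in> torsion_elements (Q C)}"
  proof (intro equalityI subsetI)
    fix x assume "x \<in> torsion_elements (Q A)"
    then obtain n :: nat where n: "x \<in> carrier (Q A)" "n > 0" "x [^]\<^bsub>Q A\<^esub> n = \<one>\<^bsub>Q A\<^esub>"
      by (auto simp: torsion_elements_def)
    then have "f A x [^]\<^bsub>Q C\<^esub> n = \<one>\<^bsub>Q C\<^esub>" by (metis f.hom_nat_pow f.hom_one)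
    then show "x \<in> {x \<in> carrier (Q A). f A x \<in> torsion_elements (Q C)}"
      using n by (auto simp: torsion_elements_def)
  next
    fix x assume "x \<in> {x \<in> carrier (Q A). f A x \<in> torsion_elements (Q C)}"
    then obtain n :: nat where n: "x \<in> carrier (Q A)" "n > 0" "f A x [^]\<^bsub>Q C\<^esub> n = \<one>\<^bsub>Q C\<^esub>"
      by (auto simp: torsion_elements_def)
    then have "x [^]\<^bsub>Q A\<^esub> n \<in> {x \<in> carrier (Q A). f A x = \<one>\<^bsub>Q C\<^esub>}"
      by (simp add: f.hom_nat_pow)
    \<comment> \<open>A power of \<open>x\<close> lies in the kernel, and raising it further to the
      order of \<open>g\<close> kills it.\<close>
    then obtain k :: int where k: "x [^]\<^bsub>Q A\<^esub> n = g [^]\<^bsub>Q A\<^esub> k" using ker by auto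
    have "x [^]\<^bsub>Q A\<^esub> (n * nat \<bar>l \<sigma>\<bar>) = g [^]\<^bsub>Q A\<^esub> (k * int (nat \<bar>l \<sigma>\<bar>))"
      using n g k by (metis QA.int_pow_pow QA.nat_pow_pow int_pow_int)
    also have "\<dots> = \<one>\<^bsub>Q A\<^esub>" by (subst g_pow) simp
    finally show "x \<in> torsion_elements (Q A)"
      using n l(2) by (auto simp: torsion_elements_def intro!: exI[of _ "n * nat \<bar>l \<sigma>\<bar>"])
  qed
  \<comment> \<open>Translation by a preimage \<open>x0\<close> of \<open>y\<close> carries the
    kernel bijectively to the fibre.\<close>
  have fiber: "card {x \<in> torsion_elements (Q A). f A x = y} = nat \<bar>l \<sigma>\<bar>"
    if y: "y \<in> torsion_elements (Q C)" for y
  proof -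
    have "y \<in> carrier (Q C)" using y by (auto simp: torsion_elements_def)
    then have "y \<in> f A ` carrier (Q A)" by (simp only: surj)
    then obtain x0 where x0: "x0 \<in> carrier (Q A)" "f A x0 = y" by (elim imageE) simp
    have "bij_betw (\<lambda>x. x0 \<otimes>\<^bsub>Q A\<^esub> x) {x \<in> carrier (Q A). f A x = \<one>\<^bsub>Q C\<^esub>}
        {x \<in> torsion_elements (Q A). f A x = y}"
    proof (rule bij_betwI[where g = "\<lambda>x. inv\<^bsub>Q A\<^esub> x0 \<otimes>\<^bsub>Q A\<^esub> x"])
      show "x0 \<otimes>\<^bsub>Q A\<^esub> (inv\<^bsub>Q A\<^esub> x0 \<otimes>\<^bsub>Q A\<^esub> x) = x"
        if "x \<in> {x \<in> torsion_elements (Q A). f A x = y}" for x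
        using that x0 unfolding torsion by (simp flip: QA.m_assoc)
      show "inv\<^bsub>Q A\<^esub> x0 \<otimes>\<^bsub>Q A\<^esub> (x0 \<otimes>\<^bsub>Q A\<^esub> x) = x"
        if "x \<in> {x \<in> carrier (Q A). f A x = \<one>\<^bsub>Q C\<^esub>}" for x
        using that x0 by (simp flip: QA.m_assoc)
      show "(\<lambda>x. x0 \<otimes>\<^bsub>Q A\<^esub> x) \<in> {x \<in> carrier (Q A). f A x = \<one>\<^bsub>Q C\<^esub>}
          \<rightarrow> {x \<in> torsion_elements (Q A). f A x = y}"
        unfolding torsion using x0 y \<open>y \<in> carrier (Q C)\<close> by simp
      show "(\<lambda>x. inv\<^bsub>Q A\<^esub> x0 \<otimes>\<^bsub>Q A\<^esub> x) \<in> {x \<in> torsion_elements (Q A). f A x = y}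
          \<rightarrow> {x \<in> carrier (Q A). f A x = \<one>\<^bsub>Q C\<^esub>}"
        unfolding torsion using x0 \<open>y \<in> carrier (Q C)\<close> by simp
    qed
    from bij_betw_same_card[OF this] show ?thesis by (simp only: card_ker)
  qed
  have img: "f A ` torsion_elements (Q A) = torsion_elements (Q C)"
  proof -
    have "torsion_elements (Q C) \<subseteq> f A ` carrier (Q A)"
      unfolding surj by (auto simp: torsion_elements_def)
    then show ?thesis unfolding torsion by blast
  qed
  have "card (torsion_elements (Q A))
      = (\<Sum>y\<in>f A ` torsion_elements (Q A). \<Sum>x\<in>{x \<in> torsion_elements (Q A). f A x = y}. 1)"
    using sum.image_gen[OF finite_torsion[OF A], of "\<lambda>_. 1::nat" "f A"] by simp
  also have "\<dots> = (\<Sum>y\<in>torsion_elements (Q C). nat \<bar>l \<sigma>\<bar>)"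
    unfolding img using fiber by (intro sum.cong) auto
  finally show ?thesis by (simp add: A_def mult.commute)
qed

text \<open>Positivity rests on finiteness, since \<open>card\<close> of an infinite set is
  0.\<close>

lemma card_torsion_pos: "card (torsion_elements (Q C)) > 0"
proof -
  interpret QC: comm_group "Q C" using Q[OF order_refl] .
  have "\<one>\<^bsub>Q C\<^esub> \<in> torsion_elements (Q C)" by (auto simp: torsion_elements_def)
  then show ?thesis using finite_torsion[of C] by (auto simp: card_gt_0_iff)
qed

end

subsection \<open>Circuits of the cellular matroid\<close>

text \<open>Reduced homology is the kernel of the map to the homology of a point. That target is
  torsion-free, so every torsion element lies in the kernel.\<close>

lemma torsion_elements_reduced_homology:
  "torsion_elements (reduced_homology_group p X) = torsion_elements (homology_group p X)"
proof -
  let ?H = "homology_group p X" and ?K = "homology_group p (discrete_topology {()})"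
  let ?h = "hom_induced p X {} (discrete_topology {()}) {} (\<lambda>x. ())"
  interpret h: group_hom ?H ?K ?h
    by (simp add: group_hom_def group_hom_axioms_def hom_induced_hom)
  have pow: "x [^]\<^bsub>reduced_homology_group p X\<^esub> n = x [^]\<^bsub>?H\<^esub> n" for x and n :: nat
    unfolding reduced_homology_group_def by (simp add: pow_subgroup_generated)
  have free: "y = \<one>\<^bsub>?K\<^esub>" if y: "y \<in> carrier ?K" "y [^]\<^bsub>?K\<^esub> n = \<one>\<^bsub>?K\<^esub>" "n > 0" for y and n :: nat
  proof (cases "p = 0")
    case False
    then show ?thesis
      using homology_dimension_axiom[of "discrete_topology {()}" "()" p] y(1)
      by (auto simp: trivial_group_def)
  next
    case True
    have "?K \<cong> integer_group"
      using homology_coefficients[of "discrete_topology {()}" "()"] True by simp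
    then obtain g where g: "g \<in> iso ?K integer_group" by (auto simp: is_iso_def)
    interpret g: group_hom ?K integer_group g
      using g by (simp add: group_hom_def group_hom_axioms_def iso_def)
    have "int n * g y = 0"
      using g.hom_nat_pow[OF y(1), of n] g.hom_one y(2) by simp
    then have "g y = g \<one>\<^bsub>?K\<^esub>" using y(3) g.hom_one by simp
    then show ?thesis
      using g y(1) h.H.one_closed by (auto simp: iso_def bij_betw_def inj_on_def)
  qed
  have "x \<in> carrier (reduced_homology_group p X)"
    if x: "x \<in> carrier ?H" "x [^]\<^bsub>?H\<^esub> n = \<one>\<^bsub>?H\<^esub>" "n > 0" for x and n :: nat
  proof -
    have "?h x [^]\<^bsub>?K\<^esub> n = \<one>\<^bsub>?K\<^esub>"
      using h.hom_nat_pow[OF x(1), of n] x(2) h.hom_one by simp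
    then show ?thesis
      using free[of "?h x" n] x h.hom_closed by (simp add: carrier_reduced_homology_group kernel_def)
  qed
  then show ?thesis
    using carrier_reduced_homology_group_subset[of p X]
    by (auto simp: torsion_elements_def pow one_reduced_homology_group)
qed

lemma torsion_number_eq: "torsion_number p X = card (torsion_elements (homology_group p X))"
  by (simp add: torsion_number_def torsion_elements_reduced_homology)

text \<open>Serves the case \<open>d = 0\<close>, where torsion is taken in degree -1.\<close>

lemma torsion_number_negative:
  assumes "p < 0"
  shows "torsion_number p X = 1"
proof -
  let ?H = "homology_group p X"
  have "carrier ?H = {\<one>\<^bsub>?H\<^esub>}"
    using trivial_homology_group[OF assms, of X] by (simp add: trivial_group_def)
  moreover have "\<one>\<^bsub>?H\<^esub> [^]\<^bsub>?H\<^esub> (1::nat) = \<one>\<^bsub>?H\<^esub>"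
    by (simp add: group.is_monoid monoid.nat_pow_one)
  ultimately have "torsion_elements ?H = {\<one>\<^bsub>?H\<^esub>}"
    unfolding torsion_elements_def by (auto intro!: exI[of _ "1::nat"])
  then show ?thesis by (simp add: torsion_number_eq)
qed

section \<open>Matroid independence as absence of real relations\<close>

lemma sum_fun_apply: "(\<Sum>e\<in>A. g e :: 'b \<Rightarrow> real) r = (\<Sum>e\<in>A. g e r)"
  by (induction A rule: infinite_finite_induct) auto

lemma sum_columns_eq_0_iff:
  "(\<Sum>e\<in>A. x e *\<^sub>R boundary_column S e) = 0 \<longleftrightarrow> (\<forall>r. (\<Sum>e\<in>A. x e * incidence S e r) = 0)"
  by (auto simp: fun_eq_iff sum_fun_apply scaleR_fun_def boundary_column_def)

text \<open>Relations are indexed by facets instead of columns, which absorbs the injectivity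
  condition: facets with equal columns are dependent through their difference.\<close>

lemma cellular_matroid_indep_iff:
  assumes "finite A" "A \<subseteq> n_cells S d"
  shows "cellular_matroid_indep S d A \<longleftrightarrow>
    (\<forall>x::'c \<Rightarrow> real. (\<forall>r. (\<Sum>e\<in>A. x e * incidence S e r) = 0) \<longrightarrow> (\<forall>e\<in>A. x e = 0))"
    (is "_ = (\<forall>x. ?rel x \<longrightarrow> ?zero x)")
proof
  assume indep: "cellular_matroid_indep S d A"
  show "\<forall>x. ?rel x \<longrightarrow> ?zero x"
  proof (intro allI impI ballI)
    fix x e assume x: "?rel x" and e: "e \<in> A"
    let ?c = "boundary_column S"
    have inj: "inj_on ?c A" and ind: "independent (?c ` A)"
      using indep by (auto simp: cellular_matroid_indep_def)
    \<comment> \<open>Coefficients on facets are transported to columns by inverting the injective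
      column map.\<close>
    have "(\<Sum>v\<in>?c ` A. x (the_inv_into A ?c v) *\<^sub>R v) = (\<Sum>e\<in>A. x e *\<^sub>R ?c e)"
      using inj by (subst sum.reindex) (auto simp: the_inv_into_f_f intro!: sum.cong)
    also have "\<dots> = 0" using x sum_columns_eq_0_iff by blast
    finally have "x (the_inv_into A ?c (?c e)) = 0"
      using e independentD[OF ind finite_imageI[OF assms(1)] order_refl,
          of "\<lambda>v. x (the_inv_into A ?c v)" "?c e"] by simp
    then show "x e = 0" using inj e by (simp add: the_inv_into_f_f)
  qed
next
  assume zero: "\<forall>x. ?rel x \<longrightarrow> ?zero x"
  let ?c = "boundary_column S"
  have inj: "inj_on ?c A"
  proof (rule inj_onI, rule ccontr)
    fix e f assume ef: "e \<in> A" "f \<in> A" "?c e = ?c f" "e \<noteq> f"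
    \<comment> \<open>The difference of two facets with equal columns.\<close>
    let ?x = "\<lambda>g. if g = e then 1 else if g = f then - 1 else 0 :: real"
    have "(\<Sum>g\<in>A. ?x g *\<^sub>R ?c g) = (\<Sum>g\<in>A. (if g = e then ?c g else 0) - (if g = f then ?c g else 0))"
      using ef(4) by (intro sum.cong) auto
    also have "\<dots> = (\<Sum>g\<in>A. if g = e then ?c g else 0) - (\<Sum>g\<in>A. if g = f then ?c g else 0)"
      by (rule sum_subtractf)
    also have "\<dots> = 0" using ef assms(1) by simp
    finally have "?rel ?x" by (rule sum_columns_eq_0_iff[THEN iffD1])
    then have "?zero ?x" by (rule mp[OF spec[OF zero, of ?x]])
    then have "?x e = 0" using ef(1) by (rule bspec)
    then show False by simp
  qed
  moreover have "independent (?c ` A)"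
  proof
    assume "dependent (?c ` A)"
    then obtain u where u: "\<exists>v\<in>?c ` A. u v \<noteq> 0" "(\<Sum>v\<in>?c ` A. u v *\<^sub>R v) = 0"
      using assms(1) by (auto simp: dependent_finite)
    then have "(\<Sum>e\<in>A. u (?c e) *\<^sub>R ?c e) = 0"
      using inj by (simp add: sum.reindex)
    then have "?rel (\<lambda>e. u (?c e))" by (rule sum_columns_eq_0_iff[THEN iffD1])
    then have "\<forall>e\<in>A. u (?c e) = 0"
      by (rule mp[OF spec[OF zero, of "\<lambda>e. u (?c e)"]])
    then show False using u(1) by blast
  qed
  ultimately show "cellular_matroid_indep S d A"
    using assms(2) by (simp add: cellular_matroid_indep_def)
qed

section \<open>Circuits of a CW complex as instances of the algebra\<close>

locale cw_circuit = finite_cw S for S :: "('a, 'c) cell_structure" +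
  fixes d :: nat and C :: "'c set"
  assumes circuit: "cellular_circuit S d C"
begin

lemma C_cells: "C \<subseteq> n_cells S d"
  using circuit by (simp add: cellular_circuit_def)

lemma finite_C: "finite C"
  using C_cells finite_n_cells finite_subset by blast

lemma C_dim: "e \<in> C \<Longrightarrow> cell_dim S e = d"
  using C_cells by (auto simp: n_cells_def)

text \<open>Only finitely many rows can be nonzero. For \<open>d = 0\<close> truncated subtraction
  lists the vertices as rows, where all entries vanish.\<close>

lemma incidence_outside:
  assumes "e \<in> C" "r \<notin> insert None (Some ` n_cells S (d - 1))"
  shows "incidence S e r = 0"
proof (cases r)
  case (Some f)
  show ?thesis
  proof (cases d)
    case (Suc m)
    have e: "e \<in> n_cells S (Suc m)" using assms(1) C_cells Suc by auto
    have "f \<notin> n_cells S m" using assms(2) Some Suc by auto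
    then show ?thesis
      using incidence_eq_skeleton_coords[OF e, of f] skeleton_coords_supported[of m "attaching_class (Suc m) e"]
      by (simp add: Some supported_on_def)
  qed (use assms(1) C_dim Some in simp)
qed (use assms in simp)

sublocale integer_circuit C "insert None (Some ` n_cells S (d - 1))" "incidence S"
proof
  show "\<exists>x::'c \<Rightarrow> real. (\<exists>e\<in>C. x e \<noteq> 0) \<and> (\<forall>r. (\<Sum>e\<in>C. x e * incidence S e r) = 0)"
  proof -
    have "\<not> cellular_matroid_indep S d C" using circuit by (simp add: cellular_circuit_def)
    then show ?thesis unfolding cellular_matroid_indep_iff[OF finite_C C_cells] by meson
  qed
next
  fix x :: "'c \<Rightarrow> real" and \<sigma> e
  assume x: "\<forall>r. (\<Sum>e\<in>C. x e * incidence S e r) = 0" "\<sigma> \<in> C" "x \<sigma> = 0" "e \<in> C"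
  \<comment> \<open>A relation vanishing at \<open>\<sigma>\<close> is a relation on
    \<open>C - {\<sigma>}\<close>, which is independent as a proper subset of a circuit.\<close>
  have sub: "C - {\<sigma>} \<subset> C" using x by auto
  then have "cellular_matroid_indep S d (C - {\<sigma>})"
    using circuit unfolding cellular_circuit_def by blast
  moreover have "(\<Sum>e\<in>C - {\<sigma>}. x e * incidence S e r) = 0" for r
    using x(1)[rule_format, of r] x(2,3) finite_C by (simp add: sum.remove)
  ultimately have "\<forall>e\<in>C - {\<sigma>}. x e = 0"
    using cellular_matroid_indep_iff[of "C - {\<sigma>}" S d] finite_C C_cells by blast
  then show "x e = 0" using x by (cases "e = \<sigma>") auto
qed (use finite_C finite_n_cells incidence_outside in auto)

text \<open>The abstract count is applied in degree \<open>m = d - 1\<close>, with the homology of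
  the \<open>m\<close>-skeleton, the attaching classes and the inclusions into the
  subcomplexes.\<close>

lemma torsion_number_facet_Suc:
  assumes d: "d = Suc m" and \<sigma>: "\<sigma> \<in> C" and l: "relation l" "l \<sigma> \<noteq> 0"
    and gen: "\<And>a. relation a \<Longrightarrow> \<exists>m. a = (\<lambda>e. m * l e)"
  shows "torsion_number (int d - 1) (facet_subcomplex S d (C - {\<sigma>}))
      = nat \<bar>l \<sigma>\<bar> * torsion_number (int d - 1) (facet_subcomplex S d C)"
    and "torsion_number (int d - 1) (facet_subcomplex S d C) > 0"
proof -
  let ?Z = "homology_group (int m) (skeleton_top S (int m))"
  let ?Q = "\<lambda>A. homology_group (int m) (facet_subcomplex S d A)"
  \<comment> \<open>The row \<open>None\<close> gets coordinate 0, which matches the incidence of a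
    facet of positive dimension.\<close>
  let ?\<kappa> = "\<lambda>z. case_option 0 (skeleton_coords m z)"
  have m: "int d - 1 = int m" by (simp add: d)
  interpret circuit_groups C "insert None (Some ` n_cells S (d - 1))" "incidence S" ?Z ?\<kappa>
    "attaching_class d" ?Q "skel_inc d"
    "\<lambda>A. hom_induced (int m) (facet_subcomplex S d A) {} (facet_subcomplex S d C) {} id"
  proof (intro circuit_groups.intro circuit_groups_axioms.intro)
    show "integer_circuit C (insert None (Some ` n_cells S (d - 1))) (incidence S)"
      by (rule integer_circuit_axioms)
    show "comm_group ?Z" by simp
    show "comm_group (?Q A)" for A by simp
    show "attaching_class d e \<in> carrier ?Z" for e
      using attaching_class_closed[of d e] by (simp add: m)
    show "?\<kappa> (x \<otimes>\<^bsub>?Z\<^esub> y) r = ?\<kappa> x r + ?\<kappa> y r" if "x \<in> carrier ?Z" "y \<in> carrier ?Z" for x y r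
      using skeleton_coords_mult[OF that] by (simp split: option.split)
    show "inj_on ?\<kappa> (carrier ?Z)"
    proof (rule inj_onI)
      fix x y assume xy: "x \<in> carrier ?Z" "y \<in> carrier ?Z" "?\<kappa> x = ?\<kappa> y"
      then have "?\<kappa> x (Some f) = ?\<kappa> y (Some f)" for f by (rule_tac fun_cong)
      then have "skeleton_coords m x = skeleton_coords m y" by (intro ext) simp
      then show "x = y" using inj_on_skeleton_coords xy by (auto dest: inj_onD)
    qed
    show "?\<kappa> (attaching_class d e) = incidence S e" if "e \<in> C" for e
    proof
      fix r
      have "e \<in> n_cells S (Suc m)" using that C_cells d by auto
      then show "?\<kappa> (attaching_class d e) r = incidence S e r"
        using incidence_eq_skeleton_coords C_dim[OF that] d
        by (cases r) (simp_all del: incidence.simps(2))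
    qed
    show "skel_inc d A \<in> hom ?Z (?Q A)" for A
      using hom_induced_hom[of "int m" "skeleton_top S (int m)" "{}" "facet_subcomplex S d A" "{}" id]
      by (simp only: m)
    show "skel_inc d A ` carrier ?Z = carrier (?Q A)" if "A \<subseteq> C" for A
      using surj_skel_inc[of A d] that C_cells by (simp only: m)
    show "kernel ?Z (?Q A) (skel_inc d A) = range (int_comb ?Z (attaching_class d) A)" if "A \<subseteq> C" for A
      using kernel_skel_inc[of A d] that C_cells by (simp only: m)
    show "hom_induced (int m) (facet_subcomplex S d A) {} (facet_subcomplex S d C) {} id \<in> hom (?Q A) (?Q C)" for A
      by (rule hom_induced_hom)
    show "hom_induced (int m) (facet_subcomplex S d A) {} (facet_subcomplex S d C) {} id (skel_inc d A x) = skel_inc d C x"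
      if "A \<subseteq> C" for A x
      using hom_induced_skel_inc[OF that, of d x] by (simp only: m)
  qed
  show "torsion_number (int d - 1) (facet_subcomplex S d (C - {\<sigma>}))
      = nat \<bar>l \<sigma>\<bar> * torsion_number (int d - 1) (facet_subcomplex S d C)"
    using card_torsion_facet[OF \<sigma> l gen] by (simp only: torsion_number_eq m)
  show "torsion_number (int d - 1) (facet_subcomplex S d C) > 0"
    using card_torsion_pos by (simp only: torsion_number_eq m)
qed

text \<open>All vertices have the same column, so the difference of two is a relation; being a
  multiple of \<open>l\<close>, it forces \<open>l \<sigma>\<close> to divide 1.\<close>

lemma relation_vertices:
  assumes d: "d = 0" and \<sigma>: "\<sigma> \<in> C" and l: "relation l" "l \<sigma> \<noteq> 0"
    and gen: "\<And>a. relation a \<Longrightarrow> \<exists>m. a = (\<lambda>e. m * l e)"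
  shows "\<bar>l \<sigma>\<bar> = 1"
proof -
  have inc: "incidence S e r = (if r = None then 1 else 0)" if "e \<in> C" for e r
    using C_dim[OF that] d by (cases r) auto
  \<comment> \<open>A single vertex has a nonzero column and is no circuit, so a second element
    exists.\<close>
  have "C \<noteq> {\<sigma>}"
  proof
    assume "C = {\<sigma>}"
    then have "(\<Sum>e\<in>{\<sigma>}. l e * incidence S e None) = 0" using l(1) unfolding relation_def by blast
    moreover have "incidence S \<sigma> None = 1" using inc[OF \<sigma>, of None] by (simp only: refl if_True)
    ultimately show False using l(2) by (simp del: incidence.simps)
  qed
  then obtain \<tau> where \<tau>: "\<tau> \<in> C" "\<tau> \<noteq> \<sigma>" using \<sigma> by blast
  let ?a = "\<lambda>e. (if e = \<sigma> then 1 else 0) - (if e = \<tau> then 1 else 0) :: int"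
  have "(\<Sum>e\<in>C. ?a e * incidence S e r) = 0" for r
  proof -
    have "(\<Sum>e\<in>C. ?a e * incidence S e r) = (\<Sum>e\<in>C. ?a e) * (if r = None then 1 else 0)"
      by (simp add: inc sum_distrib_right)
    also have "(\<Sum>e\<in>C. ?a e) = 0"
      using \<sigma> \<tau> finite_C by (simp add: sum_subtractf)
    finally show ?thesis by simp
  qed
  then have "relation ?a"
    using \<sigma> \<tau> by (auto simp: relation_def supported_on_def)
  then obtain m where m: "?a = (\<lambda>e. m * l e)" using gen by blast
  from fun_cong[OF m, of \<sigma>] have "m * l \<sigma> = 1" using \<tau> by simp
  then have "\<bar>l \<sigma> * m\<bar> = 1" by (simp add: mult.commute)
  then show ?thesis by (rule abs_zmult_eq_1)
qed

text \<open>\<open>T\<close> is the torsion number of the subcomplex on all of \<open>C\<close> for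
  \<open>d > 0\<close>, and 1 for \<open>d = 0\<close>.\<close>

lemma torsion_numbers_proportional:
  "\<exists>l T. relation l \<and> (\<forall>\<sigma>\<in>C. l \<sigma> \<noteq> 0) \<and> T > 0 \<and>
     (\<forall>\<sigma>\<in>C. torsion_number (int d - 1) (facet_subcomplex S d (C - {\<sigma>})) = nat \<bar>l \<sigma>\<bar> * T)"
proof -
  obtain l where l: "relation l" "\<And>\<sigma>. \<sigma> \<in> C \<Longrightarrow> l \<sigma> \<noteq> 0"
    and gen: "\<And>a. relation a \<Longrightarrow> \<exists>m. a = (\<lambda>e. m * l e)"
    using exists_generating_relation by blast
  show ?thesis
  proof (cases d)
    case 0
    have "torsion_number (int d - 1) (facet_subcomplex S d (C - {\<sigma>})) = nat \<bar>l \<sigma>\<bar> * 1" if "\<sigma> \<in> C" for \<sigma>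
      using relation_vertices[OF 0 that l(1) l(2)[OF that] gen] 0 by (simp add: torsion_number_negative)
    then show ?thesis using l by blast
  next
    case (Suc m)
    obtain \<sigma> where "\<sigma> \<in> C" using dependent by blast
    then have "torsion_number (int d - 1) (facet_subcomplex S d C) > 0"
      using torsion_number_facet_Suc(2)[OF Suc _ l(1) l(2) gen] by blast
    moreover have "torsion_number (int d - 1) (facet_subcomplex S d (C - {\<sigma>}))
        = nat \<bar>l \<sigma>\<bar> * torsion_number (int d - 1) (facet_subcomplex S d C)" if "\<sigma> \<in> C" for \<sigma>
      by (rule torsion_number_facet_Suc(1)[OF Suc that l(1) l(2)[OF that] gen])
    ultimately show ?thesis using l by blast
  qed
qed

text \<open>The boundary sum over all facets collapses to \<open>C\<close>, so flows supported on
  \<open>C\<close> are exactly the real relations of the circuit.\<close>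

lemma circuit_flow_iff:
  "x \<in> flow_space S d \<and> chain_support x \<subseteq> C \<longleftrightarrow>
     (\<forall>e. e \<notin> C \<longrightarrow> x e = 0) \<and> (\<forall>r. (\<Sum>e\<in>C. x e * incidence S e r) = 0)"
proof -
  have support: "chain_support x \<subseteq> C \<longleftrightarrow> (\<forall>e. e \<notin> C \<longrightarrow> x e = 0)"
    by (auto simp: chain_support_def)
  show ?thesis
  proof (cases "\<forall>e. e \<notin> C \<longrightarrow> x e = 0")
    case True
    then have "real_boundary S d x = (\<Sum>e\<in>C. x e *\<^sub>R boundary_column S e)"
      unfolding real_boundary_def using C_cells finite_n_cells
      by (intro sum.mono_neutral_right) (auto simp: scaleR_fun_def fun_eq_iff)
    moreover have "x \<in> real_chains S d"
      using True C_cells by (auto simp: real_chains_def)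
    ultimately show ?thesis
      using True support by (simp add: flow_space_def sum_columns_eq_0_iff del: incidence.simps)
  next
    case False
    then show ?thesis unfolding support by blast
  qed
qed

end

theorem theorem5p3:
  fixes S :: "('a, 'c) cell_structure" and d :: nat and C :: "'c set"
  assumes "finite_cw_complex S"
    and "cw_dimension S d"
    and "cellular_circuit S d C"
  shows "\<exists>\<epsilon> :: 'c \<Rightarrow> real.
    (\<forall>\<sigma> \<in> C. \<epsilon> \<sigma> \<in> {1, -1}) \<and>
    (let v = (\<Sum>\<sigma> \<in> C.
               (\<epsilon> \<sigma> * real (torsion_number (int d - 1) (facet_subcomplex S d (C - {\<sigma>})))) *\<^sub>R
               basis_chain \<sigma>);
         L = {x \<in> flow_space S d. chain_support x \<subseteq> C}
     in subspace L \<and> dim L = 1 \<and> span {v} = L \<and>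
        v \<in> flow_space S d \<and> v \<noteq> 0 \<and> chain_support v = C)"
proof -
  interpret cw_circuit S d C
    using assms by unfold_locales
  obtain l T where l: "relation l" "\<And>\<sigma>. \<sigma> \<in> C \<Longrightarrow> l \<sigma> \<noteq> 0" and T: "T > 0"
    and torsion: "\<And>\<sigma>. \<sigma> \<in> C \<Longrightarrow>
      torsion_number (int d - 1) (facet_subcomplex S d (C - {\<sigma>})) = nat \<bar>l \<sigma>\<bar> * T"
    using torsion_numbers_proportional by blast
  \<comment> \<open>These signs undo the absolute values in the torsion numbers, so that
    \<open>v\<close> becomes \<open>T\<close> times the integer relation \<open>l\<close>.\<close>
  define \<epsilon> :: "'c \<Rightarrow> real" where "\<epsilon> \<sigma> = sgn (real_of_int (l \<sigma>))" for \<sigma>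
  define v where "v = (\<Sum>\<sigma> \<in> C.
      (\<epsilon> \<sigma> * real (torsion_number (int d - 1) (facet_subcomplex S d (C - {\<sigma>})))) *\<^sub>R basis_chain \<sigma>)"
  define L where "L = {x \<in> flow_space S d. chain_support x \<subseteq> C}"
  have C_nonempty: "C \<noteq> {}" using dependent by blast
  have v: "v e = real T * real_of_int (l e)" for e
  proof -
    have "v e = (\<Sum>\<sigma>\<in>C. if \<sigma> = e then \<epsilon> \<sigma> * real (nat \<bar>l \<sigma>\<bar> * T) else 0)"
      unfolding v_def sum_fun_apply
      by (intro sum.cong) (auto simp: torsion scaleR_fun_def basis_chain_def)
    also have "\<dots> = (if e \<in> C then \<epsilon> e * real (nat \<bar>l e\<bar> * T) else 0)"
      using finite_C by simp
    also have "\<dots> = real T * real_of_int (l e)"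
      using l(1) by (auto simp: \<epsilon>_def relation_def supported_on_def sgn_if)
    finally show ?thesis .
  qed
  have L: "x \<in> L \<longleftrightarrow> (\<forall>e. e \<notin> C \<longrightarrow> x e = 0) \<and> (\<forall>r. (\<Sum>e\<in>C. x e * incidence S e r) = 0)" for x
    unfolding L_def using circuit_flow_iff by simp
  have support: "chain_support v = C"
    using l T by (auto simp: chain_support_def v relation_def supported_on_def)
  have vL: "v \<in> L"
  proof -
    have "(\<Sum>e\<in>C. v e * incidence S e r) = 0" for r
    proof -
      have "real_of_int (\<Sum>e\<in>C. l e * incidence S e r) = 0"
        using l(1) by (simp add: relation_def)
      then have "real T * (\<Sum>e\<in>C. real_of_int (l e) * real_of_int (incidence S e r)) = 0" by simp
      then show ?thesis by (simp add: v sum_distrib_left mult.assoc)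
    qed
    then show ?thesis using support by (auto simp: L chain_support_def)
  qed
  have v0: "v \<noteq> 0" using support C_nonempty by (auto simp: chain_support_def)
  have sub: "subspace L"
  proof (rule subspaceI)
    show "0 \<in> L" by (simp add: L)
    show "x + y \<in> L" if "x \<in> L" "y \<in> L" for x y
      using that by (simp add: L distrib_right sum.distrib)
    show "c *\<^sub>R x \<in> L" if "x \<in> L" for c x
      using that by (simp add: L scaleR_fun_def mult.assoc flip: sum_distrib_left)
  qed
  have span: "span {v} = L"
  proof
    show "span {v} \<subseteq> L" using vL sub by (intro span_minimal) auto
    show "L \<subseteq> span {v}"
    proof
      fix x assume x: "x \<in> L"
      then obtain t where t: "\<And>e. e \<in> C \<Longrightarrow> x e = t * real_of_int (l e)"
        using real_relation_multiple[OF l _ C_nonempty, of x] unfolding L by blast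
      \<comment> \<open>\<open>x\<close> is \<open>t\<close> times \<open>l\<close>, and
        \<open>v\<close> is \<open>T\<close> times \<open>l\<close> with \<open>T\<close>
        positive.\<close>
      have "x = (t / real T) *\<^sub>R v"
      proof
        fix e show "x e = ((t / real T) *\<^sub>R v) e"
          using x t[of e] T l(1) by (cases "e \<in> C") (auto simp: L scaleR_fun_def v relation_def supported_on_def)
      qed
      then show "x \<in> span {v}" by (simp add: span_base span_scale)
    qed
  qed
  have "dim L = 1"
    using dim_span[of "{v}"] dim_eq_card_independent[of "{v}"] v0 by (simp add: span)
  moreover have "v \<in> flow_space S d" using vL by (simp add: L_def)
  moreover have "\<forall>\<sigma>\<in>C. \<epsilon> \<sigma> \<in> {1, -1}" using l(2) by (simp add: \<epsilon>_def sgn_if)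
  ultimately show ?thesis
    unfolding Let_def
    by (intro exI[of _ \<epsilon>], fold v_def L_def) (simp add: sub span v0 support)
qed

end
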